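(* Let $\Gamma$ be a finitely generated group. If $\Gamma$ has a finite complexity rate, i.e. $\mathrm{CR}(\Gamma)<\pmb{\infty}$, then $\Gamma$ admits a coarse embedding with finite complexity into the $\ell^2$-direct sum $\bigoplus_{p=1}^\infty\ell^{2p}(\mathbb{N})$.
   Context: $\Gamma$ is endowed with a word length metric $d$. A map $\tau$ from a metric space to a Banach space has $(R,\epsilon)$-variation if $d(x,y)\le R$ implies $\|\tau(x)-\tau(y)\|\le\epsilon$. For $k\ge1$, $\mathfrak{ln}_k(x)$ equals the $k$-fold iterated logarithm $\ln(\cdots\ln(x)\cdots)$ if $x>\exp(\cdots\exp(1)\cdots)$ ($k$-fold iterated exponential of $1$), and equals $1$ otherwise; $\mathfrak{ln}=\mathfrak{ln}_1$. Let $\mathcal{D}$ be the set of all sequences $(a_0,a_1,\dots)$ with $a_p\ge0$ for all $p$ and $a_p=0$ for all but finitely many $p$, together with the sequence $(+\infty,0,0,\dots)$, ordered lexicographically: $\vec a<\vec b$ if at the first index where they differ the entry of $\vec a$ is smaller. $\frac1{\mathcal{D}}=\{\frac1{\vec a}:\vec a\in\mathcal{D}\}$ is the set of formal symbols with $\frac1{\vec a}\ge\frac1{\vec b}\iff\vec a\le\vec b$; $\pmb{0}=\frac{1}{(+\infty,0,\dots)}$ and $\pmb{\infty}=\frac1{(0,0,\dots)}$ are its minimal and maximal elements. For $\frac1{\vec a}>\pmb0$ with $\vec a=(a_0,a_1,\dots,a_k,0,\dots)\in\mathcal{D}$, write $\mathrm{CR}(\Gamma)\le\frac1{\vec a}$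 if there exist $C>0$ and maps $\tau_p:\Gamma\to\ell^{2p}(\mathbb{N})$, $p\in\mathbb{N}$, such that (1) $\tau_p$ has $\Big(1,\ \frac{C}{p^{1+a_0}(\mathfrak{ln}(p))^{a_1}\cdots(\mathfrak{ln}_k(p))^{a_k}}\Big)$-variation, and (2) there exists $N_p>0$ such that $\|\tau_p(x)-\tau_p(y)\|\ge1$ whenever $d(x,y)\ge N_p$. Write $\mathrm{CR}(\Gamma)<\frac1{\vec a}$ if there is $\vec b\in\mathcal{D}$ with $\mathrm{CR}(\Gamma)\le\frac1{\vec b}$ and $\frac1{\vec b}<\frac1{\vec a}$. Property $(H)$: $S(\cdot)$ denotes the unit sphere; a paving of a Banach space is an increasing sequence of finite-dimensional subspaces with dense union. A real Banach space $\mathscr{X}$ has Property $(H)$ if there exist pavings $\{V_n\}$ of $\mathscr{X}$, $\{W_n\}$ of a real Hilbert space $\mathscr{H}$, and a uniformly continuous map $\phi:S(\mathscr{X})\to S(\mathscr{H})$ (a Property $(H)$ map) restricting to a homeomorphism $S(V_n)\to S(W_n)$ for all $n$. The space $\ell^{q}(\mathbb{N})$ (real) has Property $(H)$ via the Mazur map $S(\ell^q(\mathbb{N}))\to S(\ell^2(\mathbb{N}))$, $\phi(x)_n=\operatorname{sign}(x_n)|x_n|^{q/2}$; this is the Property $(H)$ map used for each $\ell^{2p}(\mathbb{N})$. Coarse embedding with finite complexity: let $\mathscr{E}=\bigoplus_{p=1}^\infty\mathscr{X}_p$ be the $\ell^2$-direct sum of Property $(H)$ Banach spaces with Property $(H)$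 maps $\phi_p:S(\mathscr{X}_p)\to S(\mathscr{H})$. A map $h:\Gamma\to\mathscr{E}$ with coordinates $h_p$ is a coarse embedding with finite complexity if there exist (not necessarily non-decreasing) functions $\rho_p^\pm:[0,+\infty)\to[0,+\infty)$ such that: (1) $\rho_p^-(d(x,y))\le\|h_p(x)-h_p(y)\|\le\rho_p^+(d(x,y))$ for all $x,y\in\Gamma$, $p\ge1$; (2) $\lim_{t\to\infty}\sum_{p=1}^\infty(\rho_p^-(t))^2=+\infty$; (3) there is an integer $N\ge0$ such that for every $p>N$ the map $\phi_p$ is Lipschitz with Lipschitz constant $L_{\phi_p}$, and for each $t>0$, $\sum_{p=N+1}^\infty((L_{\phi_p}+1)\rho_p^+(t))^2<+\infty$. *)

theory Defs
  imports
    "HOL-Analysis.Analysis"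
    "HOL-Algebra.Generated_Groups"
    "HOL-Library.Function_Algebras"
    "HOL-Library.Fun_Lexorder"
begin

section \<open>Word metrics\<close>

definition word_length :: "('g, 'm) monoid_scheme \<Rightarrow> 'g set \<Rightarrow> 'g \<Rightarrow> nat" where
  "word_length G S x =
     (LEAST n. \<exists>ws. set ws \<subseteq> S \<union> m_inv G ` S \<and> length ws = n \<and> foldr (mult G) ws (one G) = x)"

definition word_dist :: "('g, 'm) monoid_scheme \<Rightarrow> 'g set \<Rightarrow> 'g \<Rightarrow> 'g \<Rightarrow> real" where
  "word_dist G S x y = real (word_length G S (mult G (m_inv G x) y))"


section \<open>Real Banach and Hilbert spaces on a carrier\<close>

text \<open>The exponent of a sequence space varies with an index, so a normed space is given by a carrier
  set inside a real vector space together with a norm, rather than by a type. Sequences are added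
  and scaled pointwise.\<close>

instantiation "fun" :: (type, scaleR) scaleR
begin
definition scaleR_fun_def: "scaleR c f = (\<lambda>x. c *\<^sub>R f x)"
instance ..
end

lemma scaleR_fun_apply [simp]: "(c *\<^sub>R f) x = c *\<^sub>R f x"
  by (simp add: scaleR_fun_def)

instance "fun" :: (type, real_vector) real_vector
  by standard (simp_all add: fun_eq_iff scaleR_add_right scaleR_add_left)

record 'a nspace =
  pts :: "'a set"
  nrm :: "'a \<Rightarrow> real"

definition norm_metric :: "'a::real_vector nspace \<Rightarrow> 'a metric" where
  "norm_metric X = metric (pts X, \<lambda>x y. nrm X (x - y))"

definition normed_space :: "'a::real_vector nspace \<Rightarrow> bool" where
  "normed_space X \<longleftrightarrow>
     subspace (pts X) \<and>
     (\<forall>x\<in>pts X. 0 \<le> nrm X x \<and> (nrm X x = 0 \<longleftrightarrow> x = 0)) \<and>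
     (\<forall>c. \<forall>x\<in>pts X. nrm X (c *\<^sub>R x) = \<bar>c\<bar> * nrm X x) \<and>
     (\<forall>x\<in>pts X. \<forall>y\<in>pts X. nrm X (x + y) \<le> nrm X x + nrm X y)"

definition banach_space :: "'a::real_vector nspace \<Rightarrow> bool" where
  "banach_space X \<longleftrightarrow> normed_space X \<and> mcomplete_of (norm_metric X)"

definition hilbert_space :: "'a::real_vector nspace \<Rightarrow> bool" where
  "hilbert_space X \<longleftrightarrow> banach_space X \<and>
     (\<exists>B::'a \<Rightarrow> 'a \<Rightarrow> real.
        (\<forall>x\<in>pts X. \<forall>y\<in>pts X. B x y = B y x) \<and>
        (\<forall>x\<in>pts X. \<forall>y\<in>pts X. \<forall>z\<in>pts X. B (x + y) z = B x z + B y z) \<and>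
        (\<forall>c. \<forall>x\<in>pts X. \<forall>y\<in>pts X. B (c *\<^sub>R x) y = c * B x y) \<and>
        (\<forall>x\<in>pts X. 0 \<le> B x x \<and> nrm X x = sqrt (B x x)))"

text \<open>The summands are indexed by \<open>p \<ge> 1\<close>; the unused coordinate \<open>0\<close> is pinned to zero.\<close>

definition l2_direct_sum :: "(nat \<Rightarrow> 'a::real_vector nspace) \<Rightarrow> (nat \<Rightarrow> 'a) nspace" where
  "l2_direct_sum X =
     \<lparr>pts = {x. (\<forall>p\<ge>1. x p \<in> pts (X p)) \<and> (\<forall>p. p \<notin> {1..} \<longrightarrow> x p = 0) \<and>
               (\<lambda>p. (nrm (X p) (x p))\<^sup>2) summable_on {1..}},
      nrm = (\<lambda>x. sqrt (\<Sum>\<^sub>\<infinity>p\<in>{1..}. (nrm (X p) (x p))\<^sup>2))\<rparr>"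

definition lp :: "real \<Rightarrow> (nat \<Rightarrow> real) nspace" where
  "lp q = \<lparr>pts = {x. summable (\<lambda>n. \<bar>x n\<bar> powr q)},
           nrm = (\<lambda>x. (\<Sum>n. \<bar>x n\<bar> powr q) powr (1 / q))\<rparr>"


section \<open>Property (H)\<close>

definition unit_sphere :: "'a::real_vector nspace \<Rightarrow> 'a set \<Rightarrow> 'a set" where
  "unit_sphere X V = {x \<in> V. nrm X x = 1}"

definition sphere_metric :: "'a::real_vector nspace \<Rightarrow> 'a set \<Rightarrow> 'a metric" where
  "sphere_metric X V = submetric (norm_metric X) (unit_sphere X V)"

definition paving :: "'a::real_vector nspace \<Rightarrow> (nat \<Rightarrow> 'a set) \<Rightarrow> bool" where
  "paving X V \<longleftrightarrow>
     (\<forall>n. subspace (V n) \<and> V n \<subseteq> pts X \<and> (\<exists>B. finite B \<and> V n = span B)) \<and>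
     incseq V \<and>
     mtopology_of (norm_metric X) closure_of (\<Union>n. V n) = pts X"

definition property_H_map ::
    "'a::real_vector nspace \<Rightarrow> 'b::real_vector nspace \<Rightarrow> ('a \<Rightarrow> 'b) \<Rightarrow> bool" where
  "property_H_map X H \<phi> \<longleftrightarrow>
     banach_space X \<and> hilbert_space H \<and>
     uniformly_continuous_map (sphere_metric X (pts X)) (sphere_metric H (pts H)) \<phi> \<and>
     (\<exists>V W. paving X V \<and> paving H W \<and>
        (\<forall>n. homeomorphic_map (mtopology_of (sphere_metric X (V n)))
                              (mtopology_of (sphere_metric H (W n))) \<phi>))"

definition mazur_map :: "real \<Rightarrow> (nat \<Rightarrow> real) \<Rightarrow> nat \<Rightarrow> real" where
  "mazur_map q x = (\<lambda>n. sgn (x n) * \<bar>x n\<bar> powr (q / 2))"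


section \<open>Coarse embeddings with finite complexity\<close>

text \<open>The Lipschitz constant is the least one; the definition is only used for Lipschitz maps.\<close>

definition lipschitz_const :: "'a metric \<Rightarrow> 'b metric \<Rightarrow> ('a \<Rightarrow> 'b) \<Rightarrow> real" where
  "lipschitz_const m1 m2 f =
     Inf {L. 0 \<le> L \<and>
          (\<forall>x\<in>mspace m1. \<forall>y\<in>mspace m1. mdist m2 (f x) (f y) \<le> L * mdist m1 x y)}"

text \<open>The series in the second growth condition takes values in \<open>[0, \<infinity>]\<close>, since nothing forces it
  to converge at a \<open>t\<close> that is not a distance between two points.\<close>

definition finite_complexity_embedding ::
    "'g set \<Rightarrow> ('g \<Rightarrow> 'g \<Rightarrow> real) \<Rightarrow> (nat \<Rightarrow> 'a::real_vector nspace) \<Rightarrow> 'b::real_vector nspace \<Rightarrow>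
     (nat \<Rightarrow> 'a \<Rightarrow> 'b) \<Rightarrow> ('g \<Rightarrow> nat \<Rightarrow> 'a) \<Rightarrow> bool" where
  "finite_complexity_embedding M d X H \<phi> h \<longleftrightarrow>
     (\<forall>p\<ge>1. property_H_map (X p) H (\<phi> p)) \<and>
     h \<in> M \<rightarrow> pts (l2_direct_sum X) \<and>
     (\<exists>\<rho>\<^sub>l \<rho>\<^sub>u :: nat \<Rightarrow> real \<Rightarrow> real.
        (\<forall>p\<ge>1. \<forall>t\<ge>0. 0 \<le> \<rho>\<^sub>l p t \<and> 0 \<le> \<rho>\<^sub>u p t) \<and>
        (\<forall>p\<ge>1. \<forall>x\<in>M. \<forall>y\<in>M.
           \<rho>\<^sub>l p (d x y) \<le> nrm (X p) (h x p - h y p) \<and>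
           nrm (X p) (h x p - h y p) \<le> \<rho>\<^sub>u p (d x y)) \<and>
        ((\<lambda>t. \<Sum>\<^sub>\<infinity>p\<in>{1..}. ennreal ((\<rho>\<^sub>l p t)\<^sup>2)) \<longlongrightarrow> \<infinity>) at_top \<and>
        (\<exists>N::nat.
           (\<forall>p>N. Lipschitz_continuous_map
                    (sphere_metric (X p) (pts (X p))) (sphere_metric H (pts H)) (\<phi> p)) \<and>
           (\<forall>t>0. (\<lambda>p. ((lipschitz_const (sphere_metric (X p) (pts (X p)))
                           (sphere_metric H (pts H)) (\<phi> p) + 1) * \<rho>\<^sub>u p t)\<^sup>2)
                   summable_on {N<..})))"


section \<open>Complexity rates\<close>

definition iterated_ln :: "nat \<Rightarrow> real \<Rightarrow> real" where
  "iterated_ln k x = (if x > (exp ^^ k) 1 then (ln ^^ k) x else 1)"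

definition exponent_seqs :: "(nat \<Rightarrow> ereal) set" where
  "exponent_seqs =
     {a. (\<forall>p. 0 \<le> a p \<and> a p < \<infinity>) \<and> finite {p. a p \<noteq> 0}} \<union> {(\<lambda>_. 0)(0 := \<infinity>)}"

lemma zero_in_exponent_seqs: "(\<lambda>_. 0) \<in> exponent_seqs"
  by (simp add: exponent_seqs_def)

lemma infinity_in_exponent_seqs: "(\<lambda>_. 0)(0 := \<infinity>) \<in> exponent_seqs"
  by (simp add: exponent_seqs_def)

text \<open>\<open>recip a\<close> is the formal symbol \<open>1 / a\<close>. The order is the reverse of the lexicographic one.\<close>

typedef complexity_rate = exponent_seqs
  morphisms exponents recip
  using zero_in_exponent_seqs by blast

lemma exponents_nonneg: "0 \<le> exponents r p"
  using exponents [of r] by (auto simp: exponent_seqs_def)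

lemma finite_exponents: "finite {p. exponents r p \<noteq> 0}"
  using exponents [of r] by (auto simp: exponent_seqs_def)

instantiation complexity_rate :: linorder
begin

definition less_complexity_rate :: "complexity_rate \<Rightarrow> complexity_rate \<Rightarrow> bool" where
  "r < s \<longleftrightarrow> less_fun (exponents s) (exponents r)"

definition less_eq_complexity_rate :: "complexity_rate \<Rightarrow> complexity_rate \<Rightarrow> bool" where
  "r \<le> s \<longleftrightarrow> less_fun (exponents s) (exponents r) \<or> exponents s = exponents r"

instance
proof
  fix r s t :: complexity_rate
  show "(r < s) = (r \<le> s \<and> \<not> s \<le> r)"
    by (auto simp: less_complexity_rate_def less_eq_complexity_rate_def less_fun_irrefl
        dest: less_fun_asym)
  show "r \<le> r"
    by (simp add: less_eq_complexity_rate_def)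
  show "r \<le> s \<Longrightarrow> s \<le> t \<Longrightarrow> r \<le> t"
    by (auto simp: less_eq_complexity_rate_def intro: less_fun_trans)
  show "r \<le> s \<Longrightarrow> s \<le> r \<Longrightarrow> r = s"
    by (auto simp: less_eq_complexity_rate_def exponents_inject dest: less_fun_asym)
  have "finite {p. exponents s p \<noteq> exponents r p}"
    by (rule finite_subset [OF _ finite_UnI [OF finite_exponents [of r] finite_exponents [of s]]])
      auto
  from less_fun_trichotomy [OF this] show "r \<le> s \<or> s \<le> r"
    by (auto simp: less_eq_complexity_rate_def)
qed

end

definition rate_zero :: complexity_rate where
  "rate_zero = recip ((\<lambda>_. 0)(0 := \<infinity>))"

definition rate_infinity :: complexity_rate where
  "rate_infinity = recip (\<lambda>_. 0)"

lemma rate_zero_least: "rate_zero \<le> r"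
proof -
  have z: "exponents rate_zero = (\<lambda>_. 0)(0 := \<infinity>)"
    unfolding rate_zero_def by (rule recip_inverse [OF infinity_in_exponent_seqs])
  show ?thesis
  proof (cases "exponents r 0 = \<infinity>")
    case True
    then have "exponents r = exponents rate_zero"
      unfolding z using exponents [of r] by (auto simp: exponent_seqs_def)
    then show ?thesis
      unfolding less_eq_complexity_rate_def by blast
  next
    case False
    then have "less_fun (exponents r) (exponents rate_zero)"
      unfolding z less_fun_def by (intro exI [of _ 0]) simp
    then show ?thesis
      unfolding less_eq_complexity_rate_def by blast
  qed
qed

lemma rate_infinity_greatest: "r \<le> rate_infinity"
proof (rule ccontr)
  have z: "exponents rate_infinity = (\<lambda>_. 0)"
    unfolding rate_infinity_def by (rule recip_inverse [OF zero_in_exponent_seqs])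
  assume "\<not> r \<le> rate_infinity"
  then have "rate_infinity < r"
    by (rule not_le_imp_less)
  then obtain k where "exponents r k < 0"
    unfolding less_complexity_rate_def z less_fun_def by blast
  then show False
    using exponents_nonneg [of r k] by (simp add: not_less [symmetric])
qed

definition has_variation ::
    "'g set \<Rightarrow> ('g \<Rightarrow> 'g \<Rightarrow> real) \<Rightarrow> 'a::real_vector nspace \<Rightarrow> ('g \<Rightarrow> 'a) \<Rightarrow> real \<Rightarrow> real \<Rightarrow> bool" where
  "has_variation M d X \<tau> R \<epsilon> \<longleftrightarrow>
     (\<forall>x\<in>M. \<forall>y\<in>M. d x y \<le> R \<longrightarrow> nrm X (\<tau> x - \<tau> y) \<le> \<epsilon>)"

text \<open>The denominator of the variation bound. The product ranges over the non-zero exponents, since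
  factors with exponent zero equal one.\<close>

definition rate_denom :: "complexity_rate \<Rightarrow> nat \<Rightarrow> real" where
  "rate_denom r p =
     real p powr (1 + real_of_ereal (exponents r 0)) *
     (\<Prod>i | 1 \<le> i \<and> exponents r i \<noteq> 0. iterated_ln i (real p) powr real_of_ereal (exponents r i))"

definition CR_le :: "'g set \<Rightarrow> ('g \<Rightarrow> 'g \<Rightarrow> real) \<Rightarrow> complexity_rate \<Rightarrow> bool" where
  "CR_le M d r \<longleftrightarrow> rate_zero < r \<and>
     (\<exists>C>0. \<exists>\<tau> :: nat \<Rightarrow> 'g \<Rightarrow> nat \<Rightarrow> real. \<forall>p\<ge>1.
        \<tau> p \<in> M \<rightarrow> pts (lp (2 * real p)) \<and>
        has_variation M d (lp (2 * real p)) (\<tau> p) 1 (C / rate_denom r p) \<and>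
        (\<exists>N>0. \<forall>x\<in>M. \<forall>y\<in>M. N \<le> d x y \<longrightarrow> 1 \<le> nrm (lp (2 * real p)) (\<tau> p x - \<tau> p y)))"

definition CR_less :: "'g set \<Rightarrow> ('g \<Rightarrow> 'g \<Rightarrow> real) \<Rightarrow> complexity_rate \<Rightarrow> bool" where
  "CR_less M d r \<longleftrightarrow> (\<exists>s<r. CR_le M d s)"

end

theory Submission
  imports Defs
begin

text \<open>
  Write \<open>D p\<close> for the denominator in the variation bound, so that \<open>\<tau> p\<close> moves by at most \<open>C / D p\<close>
  along an edge of the Cayley graph. Since the group is generated by \<open>S\<close>, any two points are joined
  by a path of edges, and hence \<open>\<tau> p\<close> is Lipschitz with constant \<open>C / D p\<close>
  (\<open>variation_imp_lipschitz\<close>). The Mazur map from the sphere of \<open>lp (2 p)\<close> to that of \<open>lp 2\<close> is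
  Lipschitz with constant at most \<open>2 p\<close> (\<open>mazur_map_lipschitz\<close>). The upper condition for an
  embedding of finite complexity therefore asks, up to constants, that \<open>(p / D p)\<^sup>2\<close> be summable.

  A rate strictly below the maximal one gives \<open>D p / p \<longlongrightarrow> \<infinity>\<close> (\<open>rate_denom_superlinear\<close>), possibly as
  slowly as a power of an iterated logarithm, so this series need not converge over all \<open>p\<close>.
  It does converge over a suitable infinite set \<open>A\<close> of indices
  (\<open>tendsto_0_imp_summable_on_infinite_subset\<close>). Put \<open>h x p = \<tau> p x - \<tau> p 1\<close> for \<open>p\<close> in \<open>A\<close> and zero
  otherwise. As \<open>t\<close> grows, more and more of the infinitely many coordinates in \<open>A\<close> separate points at
  distance \<open>t\<close> by at least 1, so the lower control series tends to infinity
  (\<open>infsum_indicator_tendsto_infinity\<close>).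

  The remaining part is functional analysis: the sequence spaces are Banach spaces, and Mazur maps
  have Property (H) (\<open>mazur_map_property_H\<close>). For the latter the inverse map is Hoelder continuous on
  spheres (\<open>mazur_map_inverse_holder\<close>), and Mazur maps and their inverses preserve the subspaces of
  sequences supported on the first \<open>n\<close> coordinates, which pave both spaces.
\<close>


section \<open>The sequence spaces\<close>

lemma lp_mem [simp]: "x \<in> pts (lp q) \<longleftrightarrow> summable (\<lambda>n. \<bar>x n\<bar> powr q)"
  by (simp add: lp_def)

lemma lp_nrm: "nrm (lp q) x = (\<Sum>n. \<bar>x n\<bar> powr q) powr (1 / q)"
  by (simp add: lp_def)

lemma lp_nrm_nonneg [simp]: "0 \<le> nrm (lp q) x"
  by (simp add: lp_nrm)

lemma lp_nrm_powr:
  assumes "0 < q" "x \<in> pts (lp q)"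
  shows "nrm (lp q) x powr q = (\<Sum>n. \<bar>x n\<bar> powr q)"
  using assms suminf_nonneg [of "\<lambda>n. \<bar>x n\<bar> powr q"] by (simp add: lp_nrm powr_powr)

lemma lp_nrm_minus_commute: "nrm (lp q) (x - y) = nrm (lp q) (y - x)"
  by (simp add: lp_nrm abs_minus_commute)

lemma lp_partial_sum_le:
  assumes "0 < q" "x \<in> pts (lp q)"
  shows "(\<Sum>n<m. \<bar>x n\<bar> powr q) \<le> nrm (lp q) x powr q"
  using assms by (auto simp: lp_nrm_powr intro: sum_le_suminf)

text \<open>Both membership in the space and the norm bound are read off from the finite partial sums, so that
  no later estimate has to establish convergence separately.\<close>

lemma lp_nrm_leI:
  assumes "0 < q" "0 \<le> r" and le: "\<And>m. (\<Sum>n<m. \<bar>x n\<bar> powr q) \<le> r powr q"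
  shows "x \<in> pts (lp q)" "nrm (lp q) x \<le> r"
proof -
  have s: "summable (\<lambda>n. \<bar>x n\<bar> powr q)"
    by (rule summableI_nonneg_bounded [OF _ le]) simp
  then show "x \<in> pts (lp q)" by simp
  have "(\<Sum>n. \<bar>x n\<bar> powr q) \<le> r powr q"
    by (rule suminf_le_const [OF s le])
  then have "nrm (lp q) x \<le> (r powr q) powr (1 / q)"
    unfolding lp_nrm using assms(1) s by (intro powr_mono2) (auto intro: suminf_nonneg)
  then show "nrm (lp q) x \<le> r"
    using assms by (simp add: powr_powr)
qed

lemma lp_coordinate_le:
  assumes "0 < q" "x \<in> pts (lp q)"
  shows "\<bar>x n\<bar> \<le> nrm (lp q) x"
proof -
  have "\<bar>x n\<bar> powr q \<le> (\<Sum>i<Suc n. \<bar>x i\<bar> powr q)"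
    by (rule member_le_sum) auto
  also have "\<dots> \<le> nrm (lp q) x powr q"
    by (rule lp_partial_sum_le [OF assms])
  finally show ?thesis
    using assms(1) powr_less_mono2 [of q "nrm (lp q) x" "\<bar>x n\<bar>"] lp_nrm_nonneg [of q x]
    by linarith
qed

lemma lp_scaleR:
  assumes "0 < q" "x \<in> pts (lp q)"
  shows "c *\<^sub>R x \<in> pts (lp q)" "nrm (lp q) (c *\<^sub>R x) = \<bar>c\<bar> * nrm (lp q) x"
  using assms suminf_nonneg [of "\<lambda>n. \<bar>x n\<bar> powr q"]
  by (auto simp: lp_nrm abs_mult powr_mult suminf_mult powr_powr intro: summable_mult)

lemma powr_convex_nonneg:
  fixes q :: real
  assumes "1 \<le> q" "0 \<le> a" "0 \<le> b" "0 \<le> u" "0 \<le> v" "u + v = 1"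
  shows "(u * a + v * b) powr q \<le> u * a powr q + v * b powr q"
proof -
  have contract: "(w * c) powr q \<le> w * c powr q" if "0 \<le> w" "w \<le> 1" "0 \<le> c" for w c :: real
  proof -
    have "w powr q \<le> w"
      using that assms(1) powr_mono' [of 1 q w] by (cases "w = 0") auto
    then show ?thesis
      using that by (simp add: powr_mult mult_right_mono)
  qed
  show ?thesis
  proof (cases "a = 0 \<or> b = 0")
    case True
    then show ?thesis
      using contract [of u a] contract [of v b] assms by auto
  next
    case False
    then have "((1 - v) *\<^sub>R a + v *\<^sub>R b) powr q \<le> (1 - v) * a powr q + v * b powr q"
      using assms by (intro convex_onD [OF powr_convex [OF assms(1)]]) auto
    moreover have "1 - v = u"
      using assms by simp
    ultimately show ?thesis
      by (simp only: real_scaleR_def)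
  qed
qed

text \<open>Minkowski's inequality by convexity: \<open>(x + y) / (a + b)\<close> is a convex combination of
  \<open>x / a\<close> and \<open>y / b\<close>, both of which lie in the unit ball. Allowing \<open>a\<close> and \<open>b\<close> to exceed the
  norms avoids dividing by the norm of a zero vector.\<close>

lemma lp_triangle_bound:
  assumes q: "1 \<le> q" and x: "x \<in> pts (lp q)" and y: "y \<in> pts (lp q)"
    and "0 < a" "nrm (lp q) x \<le> a" "0 < b" "nrm (lp q) y \<le> b"
  shows "x + y \<in> pts (lp q)" "nrm (lp q) (x + y) \<le> a + b"
proof -
  have le: "(\<Sum>n<m. \<bar>(x + y) n\<bar> powr q) \<le> (a + b) powr q" for m
  proof -
    have pt: "\<bar>(x + y) n\<bar> powr q
        \<le> (a + b) powr q * (a / (a + b) * (\<bar>x n\<bar> powr q / a powr q)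
                         + b / (a + b) * (\<bar>y n\<bar> powr q / b powr q))" for n
    proof -
      have "\<bar>(x + y) n\<bar> powr q \<le> ((a + b) * (a / (a + b) * (\<bar>x n\<bar> / a) + b / (a + b) * (\<bar>y n\<bar> / b))) powr q"
      proof (rule powr_mono2)
        have "(a + b) * (a / (a + b) * (\<bar>x n\<bar> / a) + b / (a + b) * (\<bar>y n\<bar> / b)) = \<bar>x n\<bar> + \<bar>y n\<bar>"
          using assms by (simp add: distrib_left)
        then show "\<bar>(x + y) n\<bar> \<le> (a + b) * (a / (a + b) * (\<bar>x n\<bar> / a) + b / (a + b) * (\<bar>y n\<bar> / b))"
          by simp
      qed (use q in auto)
      also have "\<dots> = (a + b) powr q * (a / (a + b) * (\<bar>x n\<bar> / a) + b / (a + b) * (\<bar>y n\<bar> / b)) powr q"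
        by (rule powr_mult)
      also have "\<dots> \<le> (a + b) powr q * (a / (a + b) * (\<bar>x n\<bar> / a) powr q + b / (a + b) * (\<bar>y n\<bar> / b) powr q)"
        using assms by (intro mult_left_mono powr_convex_nonneg) (auto simp: add_divide_distrib [symmetric])
      finally show ?thesis
        using assms by (simp add: powr_divide)
    qed
    have le1: "(\<Sum>n<m. \<bar>z n\<bar> powr q) / c powr q \<le> 1"
      if "z \<in> pts (lp q)" "0 < c" "nrm (lp q) z \<le> c" for z c
    proof -
      have "(\<Sum>n<m. \<bar>z n\<bar> powr q) \<le> nrm (lp q) z powr q"
        using that q by (intro lp_partial_sum_le) auto
      also have "\<dots> \<le> c powr q"
        using that q by (intro powr_mono2) auto
      finally show ?thesis using that by simp
    qed
    have "(\<Sum>n<m. \<bar>(x + y) n\<bar> powr q)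
        \<le> (\<Sum>n<m. (a + b) powr q * (a / (a + b) * (\<bar>x n\<bar> powr q / a powr q)
                         + b / (a + b) * (\<bar>y n\<bar> powr q / b powr q)))"
      by (rule sum_mono) (rule pt)
    also have "\<dots> = (a + b) powr q * (a / (a + b) * ((\<Sum>n<m. \<bar>x n\<bar> powr q) / a powr q)
                         + b / (a + b) * ((\<Sum>n<m. \<bar>y n\<bar> powr q) / b powr q))"
      by (simp add: sum_distrib_left [symmetric] sum.distrib sum_divide_distrib [symmetric])
    also have "\<dots> \<le> (a + b) powr q * (a / (a + b) * 1 + b / (a + b) * 1)"
      using assms by (intro mult_left_mono add_mono le1) auto
    also have "\<dots> = (a + b) powr q"
      using assms by (simp add: add_divide_distrib [symmetric])
    finally show ?thesis .
  qed
  show "x + y \<in> pts (lp q)" "nrm (lp q) (x + y) \<le> a + b"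
    using assms by (intro lp_nrm_leI [of q "a + b" "x + y", OF _ _ le]; linarith)+
qed

lemma lp_add:
  assumes "1 \<le> q" "x \<in> pts (lp q)" "y \<in> pts (lp q)"
  shows "x + y \<in> pts (lp q)"
  by (rule lp_triangle_bound(1) [OF assms, of "nrm (lp q) x + 1" "nrm (lp q) y + 1"])
    (auto intro: add_nonneg_pos)

lemma lp_triangle:
  assumes "1 \<le> q" "x \<in> pts (lp q)" "y \<in> pts (lp q)"
  shows "nrm (lp q) (x + y) \<le> nrm (lp q) x + nrm (lp q) y"
proof (rule field_le_epsilon)
  fix e :: real assume "0 < e"
  then show "nrm (lp q) (x + y) \<le> nrm (lp q) x + nrm (lp q) y + e"
    using lp_triangle_bound(2) [OF assms, of "nrm (lp q) x + e / 2" "nrm (lp q) y + e / 2"]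
    by (auto simp: add_nonneg_pos)
qed

lemma lp_zero: "0 \<in> pts (lp q)" "nrm (lp q) 0 = 0"
  by (auto simp: lp_nrm)

lemma lp_nrm_eq_0:
  assumes "0 < q" "x \<in> pts (lp q)"
  shows "nrm (lp q) x = 0 \<longleftrightarrow> x = 0"
proof
  assume "nrm (lp q) x = 0"
  then have "\<bar>x n\<bar> \<le> 0" for n
    using lp_coordinate_le [OF assms, of n] by simp
  then show "x = 0" by (simp add: fun_eq_iff)
qed (simp add: lp_zero)

lemma lp_subspace: "1 \<le> q \<Longrightarrow> subspace (pts (lp q))"
  unfolding subspace_def using lp_zero lp_add lp_scaleR(1) by (meson less_le_trans zero_less_one)

lemma lp_diff: "1 \<le> q \<Longrightarrow> x \<in> pts (lp q) \<Longrightarrow> y \<in> pts (lp q) \<Longrightarrow> x - y \<in> pts (lp q)"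
  by (rule subspace_diff [OF lp_subspace])

lemma lp_normed_space: "1 \<le> q \<Longrightarrow> normed_space (lp q)"
  unfolding normed_space_def
  using lp_subspace lp_nrm_nonneg lp_nrm_eq_0 lp_scaleR(2) lp_triangle
  by (meson less_le_trans zero_less_one)

lemma lp_Metric_space:
  assumes "1 \<le> q"
  shows "Metric_space (pts (lp q)) (\<lambda>x y. nrm (lp q) (x - y))"
proof
  fix x y z assume xyz: "x \<in> pts (lp q)" "y \<in> pts (lp q)" "z \<in> pts (lp q)"
  show "nrm (lp q) (x - z) \<le> nrm (lp q) (x - y) + nrm (lp q) (y - z)"
    using lp_triangle [OF assms lp_diff [OF assms xyz(1,2)] lp_diff [OF assms xyz(2,3)]] by simp
next
  fix x y assume "x \<in> pts (lp q)" "y \<in> pts (lp q)"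
  then show "nrm (lp q) (x - y) = 0 \<longleftrightarrow> x = y"
    using lp_nrm_eq_0 [of q "x - y"] lp_diff [OF assms, of x y] assms by simp
qed (auto simp: lp_nrm_minus_commute)

text \<open>The limit is taken coordinatewise; letting the second index of the Cauchy condition tend to infinity
  in each finite partial sum turns it into convergence in norm.\<close>

lemma lp_mcomplete:
  assumes q: "1 \<le> q"
  shows "mcomplete_of (norm_metric (lp q))"
proof -
  interpret Metric_space "pts (lp q)" "\<lambda>x y. nrm (lp q) (x - y)"
    by (rule lp_Metric_space [OF q])
  have q0: "0 < q" using q by simp
  have "\<exists>x. limitin mtopology \<sigma> x sequentially" if \<sigma>: "MCauchy \<sigma>" for \<sigma>
  proof -
    have mem: "\<sigma> k \<in> pts (lp q)" for k
      using \<sigma> by (auto simp only: MCauchy_def)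
    have cau: "\<exists>N. \<forall>k l. N \<le> k \<longrightarrow> N \<le> l \<longrightarrow> nrm (lp q) (\<sigma> k - \<sigma> l) < e" if "0 < e" for e
      using \<sigma> that unfolding MCauchy_def by blast
    have "Cauchy (\<lambda>k. \<sigma> k n)" for n
    proof (rule metric_CauchyI)
      fix e :: real assume "0 < e"
      then obtain N where N: "\<And>k l. N \<le> k \<Longrightarrow> N \<le> l \<Longrightarrow> nrm (lp q) (\<sigma> k - \<sigma> l) < e"
        using cau by blast
      have "dist (\<sigma> k n) (\<sigma> l n) < e" if "N \<le> k" "N \<le> l" for k l
        using lp_coordinate_le [OF q0 lp_diff [OF q mem mem], of k l n] N [OF that]
        by (simp add: dist_real_def)
      then show "\<exists>N. \<forall>k\<ge>N. \<forall>l\<ge>N. dist (\<sigma> k n) (\<sigma> l n) < e" by blast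
    qed
    then have "\<forall>n. \<exists>a. (\<lambda>k. \<sigma> k n) \<longlonglongrightarrow> a"
      by (meson Cauchy_convergent convergent_def)
    then obtain x where x: "\<And>n. (\<lambda>k. \<sigma> k n) \<longlonglongrightarrow> x n"
      by metis
    have close: "\<exists>N. \<forall>k\<ge>N. \<sigma> k - x \<in> pts (lp q) \<and> nrm (lp q) (\<sigma> k - x) \<le> e" if "0 < e" for e
    proof -
      obtain N where N: "\<And>k l. N \<le> k \<Longrightarrow> N \<le> l \<Longrightarrow> nrm (lp q) (\<sigma> k - \<sigma> l) < e"
        using cau \<open>0 < e\<close> by blast
      have "(\<Sum>n<m. \<bar>(\<sigma> k - x) n\<bar> powr q) \<le> e powr q" if "N \<le> k" for k m
      proof (rule tendsto_upperbound)
        show "(\<lambda>l. \<Sum>n<m. \<bar>(\<sigma> k - \<sigma> l) n\<bar> powr q) \<longlonglongrightarrow> (\<Sum>n<m. \<bar>(\<sigma> k - x) n\<bar> powr q)"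
          using q0 by (auto intro!: tendsto_sum tendsto_powr' tendsto_rabs tendsto_diff x)
        have "(\<Sum>n<m. \<bar>(\<sigma> k - \<sigma> l) n\<bar> powr q) \<le> e powr q" if "N \<le> l" for l
        proof -
          have "(\<Sum>n<m. \<bar>(\<sigma> k - \<sigma> l) n\<bar> powr q) \<le> nrm (lp q) (\<sigma> k - \<sigma> l) powr q"
            by (rule lp_partial_sum_le [OF q0 lp_diff [OF q mem mem]])
          also have "\<dots> \<le> e powr q"
            using q0 less_imp_le [OF N [OF \<open>N \<le> k\<close> that]] by (intro powr_mono2) auto
          finally show ?thesis .
        qed
        then show "\<forall>\<^sub>F l in sequentially. (\<Sum>n<m. \<bar>(\<sigma> k - \<sigma> l) n\<bar> powr q) \<le> e powr q"
          using eventually_sequentially by blast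
      qed simp
      then show ?thesis
        using lp_nrm_leI [OF q0] \<open>0 < e\<close> by (meson less_imp_le)
    qed
    have "x \<in> pts (lp q)"
    proof -
      obtain N where "\<sigma> N - x \<in> pts (lp q)"
        using close [of 1] by auto
      then have "\<sigma> N - (\<sigma> N - x) \<in> pts (lp q)"
        by (rule lp_diff [OF q mem])
      then show ?thesis by (simp only: diff_diff_eq2 add_diff_cancel_left')
    qed
    moreover have "\<exists>N. \<forall>k\<ge>N. \<sigma> k \<in> pts (lp q) \<and> nrm (lp q) (\<sigma> k - x) < e" if "0 < e" for e
      using close [of "e / 2"] that mem by fastforce
    ultimately show ?thesis
      unfolding limit_metric_sequentially by blast
  qed
  then have "mcomplete"
    unfolding mcomplete_def by blast
  then show ?thesis
    by (simp add: norm_metric_def)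
qed

lemma lp_banach_space: "1 \<le> q \<Longrightarrow> banach_space (lp q)"
  by (simp add: banach_space_def lp_normed_space lp_mcomplete)

lemma abs_powr_2: "\<bar>a::real\<bar> powr 2 = a\<^sup>2"
  by (cases "a = 0") auto

lemma l2_hilbert_space: "hilbert_space (lp 2)"
proof -
  have prod: "summable (\<lambda>n. x n * y n)" if "x \<in> pts (lp 2)" "y \<in> pts (lp 2)" for x y :: "nat \<Rightarrow> real"
  proof (rule summable_comparison_test')
    show "summable (\<lambda>n. (x n)\<^sup>2 + (y n)\<^sup>2)"
      using that by (intro summable_add) (simp_all add: abs_powr_2)
    show "norm (x n * y n) \<le> (x n)\<^sup>2 + (y n)\<^sup>2" for n
    proof -
      have "0 \<le> \<bar>x n\<bar> * \<bar>y n\<bar>" by simp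
      then have "\<bar>x n\<bar> * \<bar>y n\<bar> \<le> (x n)\<^sup>2 + (y n)\<^sup>2"
        using sum_squares_bound [of "\<bar>x n\<bar>" "\<bar>y n\<bar>"] unfolding power2_abs by linarith
      then show ?thesis by (simp add: abs_mult)
    qed
  qed
  show ?thesis
    unfolding hilbert_space_def
  proof (intro conjI exI [of _ "\<lambda>x y. \<Sum>n. x n * y n"] ballI allI)
    fix x y :: "nat \<Rightarrow> real"
    show "(\<Sum>n. x n * y n) = (\<Sum>n. y n * x n)"
      by (simp add: mult.commute)
    assume x: "x \<in> pts (lp 2)" and y: "y \<in> pts (lp 2)"
    show "(\<Sum>n. (c *\<^sub>R x) n * y n) = c * (\<Sum>n. x n * y n)" for c
      using suminf_mult [OF prod [OF x y], of c] by (simp add: mult.assoc)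
    fix z :: "nat \<Rightarrow> real" assume z: "z \<in> pts (lp 2)"
    show "(\<Sum>n. (x + y) n * z n) = (\<Sum>n. x n * z n) + (\<Sum>n. y n * z n)"
      using suminf_add [OF prod [OF x z] prod [OF y z]] by (simp add: distrib_right)
  next
    fix x :: "nat \<Rightarrow> real" assume x: "x \<in> pts (lp 2)"
    show "0 \<le> (\<Sum>n. x n * x n)"
      by (rule suminf_nonneg [OF prod [OF x x]]) simp
    then show "nrm (lp 2) x = sqrt (\<Sum>n. x n * x n)"
      by (simp add: lp_nrm abs_powr_2 power2_eq_square powr_half_sqrt)
  qed (simp add: lp_banach_space)
qed


section \<open>Mazur maps between unit spheres\<close>

lemma lp_norm_metric [simp]:
  assumes "1 \<le> q"
  shows "mspace (norm_metric (lp q)) = pts (lp q)"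
    and "mdist (norm_metric (lp q)) = (\<lambda>x y. nrm (lp q) (x - y))"
  using Metric_space.mspace_metric [OF lp_Metric_space [OF assms]]
    Metric_space.mdist_metric [OF lp_Metric_space [OF assms]]
  by (simp_all add: norm_metric_def)

lemma lp_sphere_metric [simp]:
  assumes "1 \<le> q"
  shows "mspace (sphere_metric (lp q) V) = unit_sphere (lp q) (V \<inter> pts (lp q))"
    and "mdist (sphere_metric (lp q) V) = (\<lambda>x y. nrm (lp q) (x - y))"
  using assms by (auto simp: sphere_metric_def unit_sphere_def)

lemma powr_diff_le:
  fixes a b s :: real
  assumes "1 \<le> s" "0 \<le> b" "b \<le> a"
  shows "a powr s - b powr s \<le> s * a powr (s - 1) * (a - b)"
proof (cases "b = 0 \<or> a = b")
  case True
  have "1 * (a powr (s - 1) * a) \<le> s * (a powr (s - 1) * a)"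
    using assms by (intro mult_right_mono) auto
  with True assms powr_mult_base [of a "s - 1"] show ?thesis
    by (auto simp: mult.commute mult.left_commute)
next
  case False
  then have "0 < b" and "b < a" using assms by auto
  moreover have "((\<lambda>x. x powr s) has_real_derivative s * x powr (s - 1)) (at x)" if "b \<le> x" for x
    using that \<open>0 < b\<close> by (intro has_real_derivative_powr) auto
  ultimately obtain c where c: "b < c" "c < a"
    and eq: "a powr s - b powr s = (a - b) * (s * c powr (s - 1))"
    using MVT2 [of b a "\<lambda>x. x powr s" "\<lambda>x. s * x powr (s - 1)"]
    by blast
  have "c powr (s - 1) \<le> a powr (s - 1)"
    using c \<open>0 < b\<close> assms by (intro powr_mono2) auto
  then show ?thesis
    using assms unfolding eq by (simp add: mult.assoc mult.commute [of "a - b"] mult_right_mono mult_left_mono)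
qed

lemma powr_superadditive:
  fixes u v s :: real
  assumes "1 \<le> s" "0 \<le> u" "0 \<le> v"
  shows "u powr s + v powr s \<le> (u + v) powr s"
proof -
  have le: "w powr s \<le> w * (u + v) powr (s - 1)" if "0 \<le> w" "w \<le> u + v" for w
  proof -
    have "w powr s = w * w powr (s - 1)"
      using powr_mult_base [of w "s - 1"] that by simp
    then show ?thesis
      using that assms by (simp add: mult_left_mono powr_mono2)
  qed
  have "u powr s + v powr s \<le> (u + v) * (u + v) powr (s - 1)"
    using le [of u] le [of v] assms by (simp add: distrib_right)
  then show ?thesis
    using powr_mult_base [of "u + v" "s - 1"] assms by simp
qed

text \<open>The Mazur map applies this odd increasing function to every coordinate.\<close>

definition signed_powr :: "real \<Rightarrow> real \<Rightarrow> real" where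
  "signed_powr s a = sgn a * \<bar>a\<bar> powr s"

lemma mazur_map_eq: "mazur_map q x = (\<lambda>n. signed_powr (q / 2) (x n))"
  by (simp add: mazur_map_def signed_powr_def)

lemma abs_signed_powr: "\<bar>signed_powr s a\<bar> = \<bar>a\<bar> powr s"
  by (cases "a = 0") (simp_all add: signed_powr_def abs_mult)

lemma signed_powr_minus: "signed_powr s (- a) = - signed_powr s a"
  by (simp add: signed_powr_def sgn_minus)

lemma signed_powr_pos: "0 \<le> a \<Longrightarrow> signed_powr s a = a powr s"
  by (cases "a = 0") (simp_all add: signed_powr_def)

lemma signed_powr_signed_powr: "signed_powr t (signed_powr s a) = signed_powr (s * t) a"
  by (cases "a = 0") (auto simp: signed_powr_def abs_mult powr_powr sgn_mult)

lemma signed_powr_1: "signed_powr 1 a = a"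
  by (simp add: signed_powr_def sgn_mult_abs)

text \<open>An inequality between \<open>a\<close> and \<open>b\<close> that is symmetric and invariant under a common change of sign
  only has to be checked when \<open>a\<close> is nonnegative and dominates \<open>b\<close> in absolute value.\<close>

lemma signed_pair_cases [case_names swap minus same opposite]:
  fixes a b :: real
  assumes swap: "\<And>a b. P a b \<Longrightarrow> P b a" and minus: "\<And>a b. P a b \<Longrightarrow> P (- a) (- b)"
    and same: "\<And>a b. 0 \<le> b \<Longrightarrow> b \<le> a \<Longrightarrow> P a b"
    and opposite: "\<And>a b. 0 \<le> b \<Longrightarrow> b \<le> a \<Longrightarrow> P a (- b)"
  shows "P a b"
proof -
  have *: "P a b" if "\<bar>b\<bar> \<le> a" for a b
    using same [of b a] opposite [of "- b" a] that by (cases "0 \<le> b") auto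
  have **: "P a b" if "\<bar>b\<bar> \<le> \<bar>a\<bar>" for a b
    using * [of b a] minus [OF * [of "- b" "- a"]] that by (cases "0 \<le> a") auto
  show ?thesis
    using ** [of b a] swap [OF ** [of a b]] by linarith
qed

lemma signed_powr_diff_le:
  assumes s: "1 \<le> s"
  shows "\<bar>signed_powr s a - signed_powr s b\<bar> \<le> s * max \<bar>a\<bar> \<bar>b\<bar> powr (s - 1) * \<bar>a - b\<bar>"
proof (induction a b rule: signed_pair_cases)
  case (swap a b)
  then show ?case by (simp add: abs_minus_commute max.commute)
next
  case (minus a b)
  then show ?case by (simp add: signed_powr_minus abs_minus_commute)
next
  case (same a b)
  then have "b powr s \<le> a powr s"
    using s by (intro powr_mono2) auto
  with same powr_diff_le [OF s same] show ?case
    by (simp add: signed_powr_pos)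
next
  case (opposite a b)
  have "b powr (s - 1) * b \<le> a powr (s - 1) * b"
    using opposite s by (intro mult_right_mono powr_mono2) auto
  then have "a powr s + b powr s \<le> a powr (s - 1) * a + a powr (s - 1) * b"
    using opposite powr_mult_base [of a "s - 1"] powr_mult_base [of b "s - 1"]
    by (simp add: mult.commute)
  also have "\<dots> \<le> s * (a powr (s - 1) * (a + b))"
    using opposite s mult_right_mono [of 1 s "a powr (s - 1) * (a + b)"] by (simp add: distrib_left)
  finally show ?case
    using opposite by (simp add: signed_powr_pos signed_powr_minus mult.assoc)
qed

text \<open>The inverse of \<open>signed_powr s\<close> is \<open>1 / s\<close>-Hoelder: superadditivity of \<open>x powr s\<close> gives this for
  numbers of equal sign, and for opposite signs \<open>\<bar>a - b\<bar>\<close> is at most twice the larger absolute value.\<close>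

lemma powr_abs_diff_le:
  assumes s: "1 \<le> s"
  shows "\<bar>a - b\<bar> powr s \<le> 2 powr s * \<bar>signed_powr s a - signed_powr s b\<bar>"
proof (induction a b rule: signed_pair_cases)
  case (swap a b)
  then show ?case by (simp add: abs_minus_commute)
next
  case (minus a b)
  then show ?case by (simp add: signed_powr_minus abs_minus_commute)
next
  case (same a b)
  then have "(a - b) powr s \<le> 1 * (a powr s - b powr s)"
    using powr_superadditive [OF s, of "a - b" b] by simp
  also have "\<dots> \<le> 2 powr s * (a powr s - b powr s)"
    using same s by (intro mult_right_mono) (auto intro: powr_mono2 ge_one_powr_ge_zero)
  finally have "(a - b) powr s \<le> 2 powr s * (a powr s - b powr s)" .
  moreover have "b powr s \<le> a powr s"
    using same s by (intro powr_mono2) auto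
  ultimately show ?case
    using same by (simp add: signed_powr_pos)
next
  case (opposite a b)
  then have "(a + b) powr s \<le> (2 * a) powr s"
    using s by (intro powr_mono2) auto
  also have "\<dots> \<le> 2 powr s * (a powr s + b powr s)"
    by (simp add: powr_mult distrib_left)
  finally show ?case
    using opposite by (simp add: signed_powr_pos signed_powr_minus)
qed

text \<open>This replaces Hoelder's inequality in the Lipschitz estimate below: it is true because both factors
  are at most the corresponding power of \<open>max m v\<close>.\<close>

lemma weighted_square_le:
  fixes m v q :: real
  assumes "2 \<le> q" "0 \<le> m" "0 \<le> v"
  shows "m powr (q - 2) * v powr 2 \<le> m powr q + v powr q"
proof -
  have "m powr (q - 2) * v powr 2 \<le> max m v powr (q - 2) * max m v powr 2"
    using assms by (intro mult_mono powr_mono2) auto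
  also have "\<dots> = max m v powr q"
    by (simp add: powr_add [symmetric])
  also have "\<dots> \<le> m powr q + v powr q"
    by (simp add: max_def)
  finally show ?thesis .
qed

lemma unit_sphere_lp_iff:
  assumes "0 < q"
  shows "x \<in> unit_sphere (lp q) (pts (lp q)) \<longleftrightarrow> (\<lambda>n. \<bar>x n\<bar> powr q) sums 1"
proof -
  have "nrm (lp q) x = 1 \<longleftrightarrow> nrm (lp q) x powr q = 1"
  proof
    assume "nrm (lp q) x powr q = 1"
    then have "(nrm (lp q) x powr q) powr (1 / q) = 1" by simp
    then show "nrm (lp q) x = 1"
      using assms by (simp add: powr_powr)
  qed simp
  then show ?thesis
    using assms lp_nrm_powr [OF assms, of x] by (auto simp: unit_sphere_def sums_iff)
qed

lemma mazur_map_unit_sphere: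
  assumes "0 < r" "p = q * r / 2" "0 < p" "x \<in> unit_sphere (lp p) (pts (lp p))"
  shows "mazur_map q x \<in> unit_sphere (lp r) (pts (lp r))"
proof -
  have "\<bar>mazur_map q x n\<bar> powr r = \<bar>x n\<bar> powr p" for n
    by (simp add: assms(2) mazur_map_eq abs_signed_powr powr_powr)
  then show ?thesis
    using assms by (simp only: unit_sphere_lp_iff)
qed

text \<open>The Mazur map with parameter \<open>q\<close> raises absolute values to the power \<open>q / 2\<close>, so its inverse is the
  Mazur map with parameter \<open>4 / q\<close>.\<close>

lemma mazur_map_inverse: "q \<noteq> 0 \<Longrightarrow> mazur_map (4 / q) (mazur_map q x) = x"
  by (simp add: mazur_map_eq signed_powr_signed_powr signed_powr_1)

text \<open>The Lipschitz constant grows only linearly in \<open>q\<close>, and this is what the rate condition can absorb.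
  With \<open>\<delta>\<close> the distance of \<open>x\<close> and \<open>y\<close>, the coordinate estimate bounds the squared difference by
  \<open>(q / 2)\<^sup>2 \<delta>\<^sup>2\<close> times \<open>m powr (q - 2) * (\<bar>x n - y n\<bar> / \<delta>)\<^sup>2\<close>. The latter is at most the sum of the
  \<open>q\<close>-th powers of \<open>\<bar>x n\<bar>\<close>, \<open>\<bar>y n\<bar>\<close> and \<open>\<bar>x n - y n\<bar> / \<delta>\<close>. These are coordinates of three unit
  vectors, so the powers sum to at most 3 over all \<open>n\<close>; rounding 3 up to 4 gives the constant \<open>q\<close>.\<close>

lemma mazur_map_lipschitz:
  assumes q: "2 \<le> q" and x: "x \<in> unit_sphere (lp q) (pts (lp q))"
    and y: "y \<in> unit_sphere (lp q) (pts (lp q))"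
  shows "nrm (lp 2) (mazur_map q x - mazur_map q y) \<le> q * nrm (lp q) (x - y)"
proof (cases "x = y")
  case True
  then show ?thesis by (simp add: lp_zero)
next
  case False
  have q0: "0 < q" and q1: "1 \<le> q" using q by auto
  have xy: "x - y \<in> pts (lp q)"
    using x y lp_diff [OF q1] by (auto simp: unit_sphere_def)
  define \<delta> where "\<delta> = nrm (lp q) (x - y)"
  have \<delta>: "0 < \<delta>"
    using lp_nrm_eq_0 [OF q0 xy] lp_nrm_nonneg [of q "x - y"] False by (simp add: \<delta>_def less_le)
  have term_le: "\<bar>(mazur_map q x - mazur_map q y) n\<bar> powr 2
      \<le> (q / 2 * \<delta>) powr 2 * (\<bar>x n\<bar> powr q + \<bar>y n\<bar> powr q + \<bar>(x - y) n\<bar> powr q / \<delta> powr q)" for n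
  proof -
    define m where "m = max \<bar>x n\<bar> \<bar>y n\<bar>"
    have m: "0 \<le> m" "m powr q \<le> \<bar>x n\<bar> powr q + \<bar>y n\<bar> powr q"
      by (auto simp: m_def max_def)
    have "\<bar>(mazur_map q x - mazur_map q y) n\<bar> powr 2
        \<le> (q / 2 * m powr (q / 2 - 1) * \<bar>x n - y n\<bar>) powr 2"
      using signed_powr_diff_le [of "q / 2" "x n" "y n"] q
      by (intro powr_mono2) (auto simp: mazur_map_eq m_def)
    also have "\<dots> = (q / 2 * \<delta>) powr 2 * (m powr (q - 2) * (\<bar>x n - y n\<bar> / \<delta>) powr 2)"
      using \<delta> by (simp add: powr_mult powr_divide powr_powr algebra_simps)
    also have "\<dots> \<le> (q / 2 * \<delta>) powr 2 * (m powr q + (\<bar>x n - y n\<bar> / \<delta>) powr q)"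
      using q m \<delta> by (intro mult_left_mono weighted_square_le) auto
    also have "\<dots> \<le> (q / 2 * \<delta>) powr 2 * (\<bar>x n\<bar> powr q + \<bar>y n\<bar> powr q + \<bar>(x - y) n\<bar> powr q / \<delta> powr q)"
      using m by (intro mult_left_mono) (auto simp: powr_divide)
    finally show ?thesis .
  qed
  have le1: "(\<Sum>n<k. \<bar>z n\<bar> powr q) \<le> 1" if "z \<in> unit_sphere (lp q) (pts (lp q))" for z k
    using lp_partial_sum_le [OF q0, of z k] that by (auto simp: unit_sphere_def)
  have le: "(\<Sum>n<k. \<bar>(mazur_map q x - mazur_map q y) n\<bar> powr 2) \<le> (q * \<delta>) powr 2" for k
  proof -
    have "(\<Sum>n<k. \<bar>(mazur_map q x - mazur_map q y) n\<bar> powr 2)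
        \<le> (\<Sum>n<k. (q / 2 * \<delta>) powr 2 *
              (\<bar>x n\<bar> powr q + \<bar>y n\<bar> powr q + \<bar>(x - y) n\<bar> powr q / \<delta> powr q))"
      by (rule sum_mono) (rule term_le)
    also have "\<dots> = (q / 2 * \<delta>) powr 2 * ((\<Sum>n<k. \<bar>x n\<bar> powr q) + (\<Sum>n<k. \<bar>y n\<bar> powr q)
              + (\<Sum>n<k. \<bar>(x - y) n\<bar> powr q) / \<delta> powr q)"
      by (simp add: sum_distrib_left [symmetric] sum.distrib sum_divide_distrib [symmetric])
    also have "\<dots> \<le> (q / 2 * \<delta>) powr 2 * (1 + 1 + 1)"
      using lp_partial_sum_le [OF q0 xy, of k] \<delta>
      by (intro mult_left_mono add_mono le1 x y) (auto simp: \<delta>_def)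
    also have "\<dots> \<le> (q / 2 * \<delta>) powr 2 * 4"
      by (intro mult_left_mono) auto
    also have "\<dots> = (q * \<delta>) powr 2"
      using q0 \<delta> by (simp add: powr_mult powr_divide)
    finally show ?thesis .
  qed
  show ?thesis
    unfolding \<delta>_def [symmetric] using q0 \<delta> by (intro lp_nrm_leI(2) [OF _ _ le]) auto
qed

lemma mazur_map_inverse_holder:
  assumes q: "2 \<le> q" and xy: "mazur_map q x - mazur_map q y \<in> pts (lp 2)"
  shows "nrm (lp q) (x - y) \<le> 2 * nrm (lp 2) (mazur_map q x - mazur_map q y) powr (2 / q)"
proof -
  define d where "d = nrm (lp 2) (mazur_map q x - mazur_map q y)"
  have le: "(\<Sum>n<k. \<bar>(x - y) n\<bar> powr q) \<le> (2 * d powr (2 / q)) powr q" for k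
  proof -
    have "\<bar>(x - y) n\<bar> powr q \<le> 2 powr q * \<bar>(mazur_map q x - mazur_map q y) n\<bar> powr 2" for n
    proof -
      have "(\<bar>x n - y n\<bar> powr (q / 2)) powr 2
          \<le> (2 powr (q / 2) * \<bar>signed_powr (q / 2) (x n) - signed_powr (q / 2) (y n)\<bar>) powr 2"
        using q by (intro powr_mono2 powr_abs_diff_le) auto
      then show ?thesis
        by (simp add: powr_powr powr_mult mazur_map_eq)
    qed
    then have "(\<Sum>n<k. \<bar>(x - y) n\<bar> powr q)
        \<le> (\<Sum>n<k. 2 powr q * \<bar>(mazur_map q x - mazur_map q y) n\<bar> powr 2)"
      by (rule sum_mono)
    also have "\<dots> = 2 powr q * (\<Sum>n<k. \<bar>(mazur_map q x - mazur_map q y) n\<bar> powr 2)"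
      by (rule sum_distrib_left [symmetric])
    also have "\<dots> \<le> 2 powr q * d powr 2"
      unfolding d_def using xy by (intro mult_left_mono lp_partial_sum_le) auto
    also have "\<dots> = (2 * d powr (2 / q)) powr q"
      using q by (simp add: powr_mult powr_powr)
    finally show ?thesis .
  qed
  show ?thesis
    unfolding d_def [symmetric] using q by (intro lp_nrm_leI(2) [OF _ _ le]) auto
qed


section \<open>Pavings by coordinate subspaces\<close>

definition coordinate_space :: "nat \<Rightarrow> (nat \<Rightarrow> real) set" where
  "coordinate_space n = {x. \<forall>i\<ge>n. x i = 0}"

lemma coordinate_space_subset_lp: "coordinate_space n \<subseteq> pts (lp q)"
proof
  fix x assume "x \<in> coordinate_space n"
  then have "summable (\<lambda>i. \<bar>x i\<bar> powr q)"
    by (intro summable_finite [of "{..<n}"]) (auto simp: coordinate_space_def)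
  then show "x \<in> pts (lp q)" by simp
qed

lemma subspace_coordinate_space: "subspace (coordinate_space n)"
  by (auto simp: subspace_def coordinate_space_def)

lemma coordinate_space_span:
  "coordinate_space n = span ((\<lambda>i j. if j = i then 1 else 0) ` {..<n})" (is "_ = span (?e ` _)")
proof
  show "span (?e ` {..<n}) \<subseteq> coordinate_space n"
    by (rule span_minimal [OF _ subspace_coordinate_space]) (auto simp: coordinate_space_def)
  show "coordinate_space n \<subseteq> span (?e ` {..<n})"
  proof
    fix x :: "nat \<Rightarrow> real" assume x: "x \<in> coordinate_space n"
    have apply_sum: "(\<Sum>i<k. x i *\<^sub>R ?e i) j = (\<Sum>i<k. x i * ?e i j)" for k j
      by (induction k) auto
    have "x = (\<Sum>i<n. x i *\<^sub>R ?e i)"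
    proof
      fix j
      show "x j = (\<Sum>i<n. x i *\<^sub>R ?e i) j"
        using x unfolding apply_sum
        by (cases "j < n") (auto simp: coordinate_space_def if_distrib [of "(*) _"] cong: if_cong)
    qed
    also have "\<dots> \<in> span (?e ` {..<n})"
      by (intro span_sum span_scale span_base) auto
    finally show "x \<in> span (?e ` {..<n})" .
  qed
qed

lemma coordinate_spaces_dense:
  assumes q: "1 \<le> q" and x: "x \<in> pts (lp q)" and "0 < e"
  shows "\<exists>y \<in> \<Union>n. coordinate_space n. nrm (lp q) (x - y) \<le> e"
proof -
  define f where "f = (\<lambda>n. \<bar>x n\<bar> powr q)"
  have f: "summable f" "\<And>n. 0 \<le> f n"
    using x by (simp_all add: f_def)
  have "0 < e powr q" using \<open>0 < e\<close> by simp
  then obtain N where "norm ((\<Sum>n<N. f n) - suminf f) < e powr q"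
    using LIMSEQ_D [OF summable_LIMSEQ [OF f(1)]] by blast
  then have N: "suminf f - (\<Sum>n<N. f n) < e powr q" by auto
  define y where "y = (\<lambda>n. if n < N then x n else 0)"
  have "(\<Sum>n<m. \<bar>(x - y) n\<bar> powr q) \<le> e powr q" for m
  proof -
    have "(\<Sum>n<m. \<bar>(x - y) n\<bar> powr q) = (\<Sum>n<m. if N \<le> n then f n else 0)"
      by (rule sum.cong) (auto simp: y_def f_def)
    also have "\<dots> = sum f {N..<m}"
      by (rule sum.mono_neutral_cong_right) auto
    also have "\<dots> \<le> suminf f - (\<Sum>n<N. f n)"
    proof -
      have "sum f {N..<m} + (\<Sum>n<N. f n) = sum f ({N..<m} \<union> {..<N})"
        by (rule sum.union_disjoint [symmetric]) auto
      also have "\<dots> \<le> suminf f"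
        by (rule sum_le_suminf [OF f(1)]) (auto simp: f(2))
      finally show ?thesis by simp
    qed
    finally show ?thesis using N by simp
  qed
  then have "nrm (lp q) (x - y) \<le> e"
    using q \<open>0 < e\<close> by (intro lp_nrm_leI(2)) auto
  moreover have "y \<in> coordinate_space N"
    by (simp add: y_def coordinate_space_def)
  ultimately show ?thesis by blast
qed

lemma coordinate_space_paving:
  assumes q: "1 \<le> q"
  shows "paving (lp q) coordinate_space"
proof -
  interpret Metric_space "pts (lp q)" "\<lambda>x y. nrm (lp q) (x - y)"
    by (rule lp_Metric_space [OF q])
  have "mtopology closure_of (\<Union>n. coordinate_space n) = pts (lp q)"
  proof
    show "pts (lp q) \<subseteq> mtopology closure_of (\<Union>n. coordinate_space n)"
    proof
      fix x assume x: "x \<in> pts (lp q)"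
      have "\<exists>y \<in> \<Union>n. coordinate_space n. y \<in> mcball x r" if r: "0 < r" for r
      proof -
        obtain y where y: "y \<in> (\<Union>n. coordinate_space n)" "nrm (lp q) (x - y) \<le> r"
          using coordinate_spaces_dense [OF q x r] by (rule bexE)
        then have "y \<in> pts (lp q)"
          using coordinate_space_subset_lp [of _ q] by (auto simp del: lp_mem)
        with x y show ?thesis unfolding in_mcball by (intro bexI [of _ y] conjI)
      qed
      with x show "x \<in> mtopology closure_of (\<Union>n. coordinate_space n)"
        unfolding metric_closure_of_alt by (intro CollectI conjI allI impI)
    qed
  qed (metis closure_of_subset_topspace topspace_mtopology)
  moreover have "\<exists>B. finite B \<and> coordinate_space n = span B" for n
    using coordinate_space_span by blast
  moreover have "incseq coordinate_space"
    by (auto simp: incseq_def coordinate_space_def)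
  ultimately show ?thesis
    unfolding paving_def
    by (simp add: norm_metric_def coordinate_space_subset_lp subspace_coordinate_space del: lp_mem)
qed


section \<open>Property (H) for Mazur maps\<close>

lemma mazur_map_coordinate_space: "x \<in> coordinate_space n \<Longrightarrow> mazur_map q x \<in> coordinate_space n"
  by (simp add: coordinate_space_def mazur_map_def)

lemma mazur_map_unit_sphere_restrict:
  assumes "0 < q"
  shows "x \<in> unit_sphere (lp q) (pts (lp q)) \<Longrightarrow> mazur_map q x \<in> unit_sphere (lp 2) (pts (lp 2))"
    and "x \<in> unit_sphere (lp 2) (pts (lp 2)) \<Longrightarrow> mazur_map (4 / q) x \<in> unit_sphere (lp q) (pts (lp q))"
  using assms by (auto intro!: mazur_map_unit_sphere)

lemma unit_sphere_Int: "unit_sphere X (A \<inter> B) = A \<inter> unit_sphere X B"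
  by (auto simp: unit_sphere_def)

lemma unit_sphere_diff:
  assumes "1 \<le> q" "x \<in> unit_sphere (lp q) (pts (lp q))" "y \<in> unit_sphere (lp q) (pts (lp q))"
  shows "x - y \<in> pts (lp q)"
  using assms lp_diff by (simp add: unit_sphere_def)

lemma mazur_map_Lipschitz_continuous:
  assumes q: "2 \<le> q"
    and V: "\<And>x. x \<in> V \<Longrightarrow> x \<in> unit_sphere (lp q) (pts (lp q)) \<Longrightarrow> mazur_map q x \<in> V'"
  shows "Lipschitz_continuous_map (sphere_metric (lp q) V) (sphere_metric (lp 2) V') (mazur_map q)"
  using q V mazur_map_lipschitz [OF q] mazur_map_unit_sphere_restrict(1) [of q]
  unfolding Lipschitz_continuous_map_def by (auto simp: unit_sphere_Int)

lemma mazur_map_inverse_uniformly_continuous: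
  assumes q: "2 \<le> q" and V: "\<And>x. x \<in> V \<Longrightarrow> mazur_map (4 / q) x \<in> V'"
  shows "uniformly_continuous_map (sphere_metric (lp 2) V) (sphere_metric (lp q) V') (mazur_map (4 / q))"
  unfolding uniformly_continuous_map_def
proof (intro conjI allI impI)
  show "mazur_map (4 / q) \<in> mspace (sphere_metric (lp 2) V) \<rightarrow> mspace (sphere_metric (lp q) V')"
    using q V mazur_map_unit_sphere_restrict(2) [of q] by (auto simp: unit_sphere_Int)
  fix e :: real assume "0 < e"
  have "nrm (lp q) (mazur_map (4 / q) y - mazur_map (4 / q) x) < e"
    if xy: "x \<in> unit_sphere (lp 2) (pts (lp 2))" "y \<in> unit_sphere (lp 2) (pts (lp 2))"
      and less: "nrm (lp 2) (y - x) < (e / 2) powr (q / 2)" for x y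
  proof -
    have inv: "mazur_map q (mazur_map (4 / q) z) = z" for z
      using mazur_map_inverse [of "4 / q" z] q by simp
    have "nrm (lp q) (mazur_map (4 / q) y - mazur_map (4 / q) x) \<le> 2 * nrm (lp 2) (y - x) powr (2 / q)"
      using mazur_map_inverse_holder [OF q, of "mazur_map (4 / q) y" "mazur_map (4 / q) x"]
        unit_sphere_diff [OF _ xy(2,1)] unfolding inv by simp
    also have "\<dots> < 2 * ((e / 2) powr (q / 2)) powr (2 / q)"
      using q less by (intro mult_strict_left_mono powr_less_mono2) auto
    also have "\<dots> = e"
      using q \<open>0 < e\<close> by (simp add: powr_powr)
    finally show ?thesis .
  qed
  then show "\<exists>\<delta>>0. \<forall>x\<in>mspace (sphere_metric (lp 2) V). \<forall>y\<in>mspace (sphere_metric (lp 2) V).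
      mdist (sphere_metric (lp 2) V) y x < \<delta> \<longrightarrow>
      mdist (sphere_metric (lp q) V') (mazur_map (4 / q) y) (mazur_map (4 / q) x) < e"
    using q \<open>0 < e\<close> by (intro exI [of _ "(e / 2) powr (q / 2)"]) (auto simp: unit_sphere_Int)
qed

text \<open>Mazur maps act coordinatewise and fix zero, so they and their inverses preserve the coordinate
  subspaces; uniform continuity of both on the whole spheres restricts to each of these.\<close>

lemma mazur_map_property_H:
  assumes q: "2 \<le> q"
  shows "property_H_map (lp q) (lp 2) (mazur_map q)"
proof -
  have q1: "1 \<le> q" using q by simp
  have homeo: "homeomorphic_map (mtopology_of (sphere_metric (lp q) (coordinate_space n)))
      (mtopology_of (sphere_metric (lp 2) (coordinate_space n))) (mazur_map q)" for n
    unfolding homeomorphic_map_maps homeomorphic_maps_def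
  proof (intro exI [of _ "mazur_map (4 / q)"] conjI ballI)
    show "continuous_map (mtopology_of (sphere_metric (lp q) (coordinate_space n)))
        (mtopology_of (sphere_metric (lp 2) (coordinate_space n))) (mazur_map q)"
      by (intro Lipschitz_continuous_imp_continuous_map mazur_map_Lipschitz_continuous q
          mazur_map_coordinate_space)
    show "continuous_map (mtopology_of (sphere_metric (lp 2) (coordinate_space n)))
        (mtopology_of (sphere_metric (lp q) (coordinate_space n))) (mazur_map (4 / q))"
      by (intro uniformly_continuous_imp_continuous_map mazur_map_inverse_uniformly_continuous q
          mazur_map_coordinate_space)
  qed (use q mazur_map_inverse [of q] mazur_map_inverse [of "4 / q"] in auto)
  have "uniformly_continuous_map (sphere_metric (lp q) (pts (lp q))) (sphere_metric (lp 2) (pts (lp 2)))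
      (mazur_map q)"
    using q mazur_map_unit_sphere_restrict(1) [of q]
    by (intro Lipschitz_imp_uniformly_continuous_map mazur_map_Lipschitz_continuous q)
      (auto simp: unit_sphere_def)
  then show ?thesis
    unfolding property_H_map_def
    by (intro conjI exI [of _ coordinate_space] allI homeo lp_banach_space q1 l2_hilbert_space
        coordinate_space_paving) simp_all
qed


section \<open>Word metrics and variation\<close>

lemma (in group) foldr_mult_closed:
  "set ws \<subseteq> carrier G \<Longrightarrow> foldr (mult G) ws \<one> \<in> carrier G"
  by (induction ws) auto

lemma (in group) foldr_mult_append:
  assumes "set us \<subseteq> carrier G" "set ws \<subseteq> carrier G"
  shows "foldr (mult G) (us @ ws) \<one> = foldr (mult G) us \<one> \<otimes> foldr (mult G) ws \<one>"
  using assms(1) by (induction us) (auto simp: m_assoc foldr_mult_closed assms(2))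

lemma (in group) generate_imp_word:
  assumes S: "S \<subseteq> carrier G" and "x \<in> generate G S"
  shows "\<exists>ws. set ws \<subseteq> S \<union> m_inv G ` S \<and> foldr (mult G) ws \<one> = x"
  using assms(2)
proof induction
  case one
  then show ?case by (intro exI [of _ "[]"]) simp
next
  case (incl h)
  with S show ?case by (intro exI [of _ "[h]"]) auto
next
  case (inv h)
  with S show ?case by (intro exI [of _ "[m_inv G h]"]) auto
next
  case (eng h1 h2)
  then obtain us ws where "set us \<subseteq> S \<union> m_inv G ` S" "foldr (mult G) us \<one> = h1"
    "set ws \<subseteq> S \<union> m_inv G ` S" "foldr (mult G) ws \<one> = h2" by blast
  moreover have "S \<union> m_inv G ` S \<subseteq> carrier G" using S by auto
  ultimately show ?case
    by (intro exI [of _ "us @ ws"] conjI) (auto simp only: foldr_mult_append set_append subset_trans)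
qed

lemma (in group) shortest_word:
  assumes "S \<subseteq> carrier G" "x \<in> generate G S"
  obtains ws where "set ws \<subseteq> S \<union> m_inv G ` S" "length ws = word_length G S x" "foldr (mult G) ws \<one> = x"
proof -
  have "\<exists>n ws. set ws \<subseteq> S \<union> m_inv G ` S \<and> length ws = n \<and> foldr (mult G) ws \<one> = x"
    using generate_imp_word [OF assms] by blast
  from LeastI_ex [OF this] that show thesis
    unfolding word_length_def by blast
qed

lemma (in group) word_length_generator_le:
  assumes "S \<subseteq> carrier G" "g \<in> S \<union> m_inv G ` S"
  shows "word_length G S g \<le> 1"
  unfolding word_length_def
  using assms by (intro Least_le exI [of _ "[g]"]) auto

lemma (in group) variation_along_word:
  assumes S: "S \<subseteq> carrier G" and X: "normed_space X" and \<tau>: "\<tau> \<in> carrier G \<rightarrow> pts X"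
    and var: "has_variation (carrier G) (word_dist G S) X \<tau> 1 \<epsilon>"
    and ws: "set ws \<subseteq> S \<union> m_inv G ` S" and x: "x \<in> carrier G"
  shows "nrm X (\<tau> x - \<tau> (x \<otimes> foldr (mult G) ws \<one>)) \<le> real (length ws) * \<epsilon>"
  using ws x
proof (induction ws arbitrary: x)
  case Nil
  have "nrm X 0 = 0"
    using X subspace_0 unfolding normed_space_def by blast
  with Nil show ?case by simp
next
  case (Cons g ws)
  have gens: "S \<union> m_inv G ` S \<subseteq> carrier G" using S by auto
  have g: "g \<in> S \<union> m_inv G ` S" "g \<in> carrier G"
    using Cons.prems gens by auto
  let ?w = "foldr (mult G) ws \<one>"
  have w: "?w \<in> carrier G"
    using Cons.prems gens by (intro foldr_mult_closed) auto
  have eq: "x \<otimes> foldr (mult G) (g # ws) \<one> = x \<otimes> g \<otimes> ?w"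
    using Cons.prems g w by (simp add: m_assoc)
  have "m_inv G x \<otimes> (x \<otimes> g) = g"
    using Cons.prems g by (simp add: m_assoc [symmetric])
  then have "word_dist G S x (x \<otimes> g) \<le> 1"
    using word_length_generator_le [OF S g(1)] by (simp add: word_dist_def)
  then have step: "nrm X (\<tau> x - \<tau> (x \<otimes> g)) \<le> \<epsilon>"
    using var Cons.prems g unfolding has_variation_def by (meson m_closed)
  have rest: "nrm X (\<tau> (x \<otimes> g) - \<tau> (x \<otimes> g \<otimes> ?w)) \<le> real (length ws) * \<epsilon>"
    using Cons g by auto
  have mem: "\<tau> a - \<tau> b \<in> pts X" if "a \<in> carrier G" "b \<in> carrier G" for a b
    using X \<tau> that unfolding normed_space_def by (intro subspace_diff) auto
  have "nrm X (\<tau> x - \<tau> (x \<otimes> g \<otimes> ?w))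
      = nrm X ((\<tau> x - \<tau> (x \<otimes> g)) + (\<tau> (x \<otimes> g) - \<tau> (x \<otimes> g \<otimes> ?w)))"
    by simp
  also have "\<dots> \<le> nrm X (\<tau> x - \<tau> (x \<otimes> g)) + nrm X (\<tau> (x \<otimes> g) - \<tau> (x \<otimes> g \<otimes> ?w))"
    using X Cons.prems g w mem unfolding normed_space_def by (meson m_closed)
  finally show ?case
    using step rest unfolding eq by (simp add: algebra_simps)
qed

text \<open>A shortest word for \<open>x\<inverse> y\<close> gives a path from \<open>x\<close> to \<open>y\<close> with steps of length at most 1, along which
  the variation bound adds up.\<close>

lemma (in group) variation_imp_lipschitz:
  assumes S: "S \<subseteq> carrier G" "generate G S = carrier G" and X: "normed_space X"
    and \<tau>: "\<tau> \<in> carrier G \<rightarrow> pts X"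
    and var: "has_variation (carrier G) (word_dist G S) X \<tau> 1 \<epsilon>"
    and xy: "x \<in> carrier G" "y \<in> carrier G"
  shows "nrm X (\<tau> x - \<tau> y) \<le> word_dist G S x y * \<epsilon>"
proof -
  have "m_inv G x \<otimes> y \<in> generate G S" using S xy by simp
  then obtain ws where ws: "set ws \<subseteq> S \<union> m_inv G ` S"
    "length ws = word_length G S (m_inv G x \<otimes> y)" "foldr (mult G) ws \<one> = m_inv G x \<otimes> y"
    using shortest_word [OF S(1)] by blast
  have "x \<otimes> foldr (mult G) ws \<one> = y"
    using xy by (simp add: ws(3) m_assoc [symmetric])
  then show ?thesis
    using variation_along_word [OF S(1) X \<tau> var ws(1) xy(1)] by (simp add: word_dist_def ws(2))
qed


section \<open>Growth of the rate denominators\<close>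

lemma funpow_ln_gt_1: "(exp ^^ k) 1 < (x::real) \<Longrightarrow> 1 < (ln ^^ k) x"
proof (induction k arbitrary: x)
  case (Suc k)
  then have "exp ((exp ^^ k) 1) < x" by simp
  then have "(exp ^^ k) 1 < ln x"
    by (metis exp_gt_zero less_trans ln_exp ln_less_cancel_iff)
  then show ?case
    using Suc.IH by (simp add: funpow_Suc_right del: funpow.simps)
qed simp

lemma iterated_ln_ge_1: "1 \<le> iterated_ln k x"
  using funpow_ln_gt_1 [of k x] by (auto simp: iterated_ln_def intro: less_imp_le)

lemma iterated_ln_at_top: "filterlim (iterated_ln k) at_top at_top"
proof -
  have "filterlim (ln ^^ k) at_top (at_top :: real filter)"
  proof (induction k)
    case 0
    show ?case by (simp add: filterlim_ident id_def)
  next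
    case (Suc k)
    from filterlim_compose [OF ln_at_top this] show ?case by (simp add: o_def)
  qed
  moreover have "\<forall>\<^sub>F x in at_top. (ln ^^ k) x = iterated_ln k x"
    using eventually_gt_at_top [of "(exp ^^ k) 1"] by eventually_elim (simp add: iterated_ln_def)
  ultimately show ?thesis
    by (simp cong: filterlim_cong)
qed

lemma powr_at_top:
  assumes "0 < (a::real)"
  shows "filterlim (\<lambda>x. x powr a) at_top at_top"
proof -
  have "filterlim (\<lambda>x. exp (a * ln x)) at_top at_top"
    by (rule filterlim_compose [OF exp_at_top
          filterlim_tendsto_pos_mult_at_top [OF tendsto_const assms ln_at_top]])
  moreover have "\<forall>\<^sub>F x in at_top. exp (a * ln x) = x powr a"
    using eventually_gt_at_top [of 0] by eventually_elim (simp add: powr_def)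
  ultimately show ?thesis
    by (simp cong: filterlim_cong)
qed

lemma exponents_finite:
  assumes "rate_zero < r"
  shows "exponents r p < \<infinity>"
proof -
  have "exponents r \<noteq> (\<lambda>_. 0)(0 := \<infinity>)"
    using assms exponents_inverse [of r] by (auto simp: rate_zero_def)
  then show ?thesis
    using exponents [of r] by (auto simp: exponent_seqs_def)
qed

lemma exponents_pos:
  assumes "r < rate_infinity"
  shows "\<exists>k. 0 < exponents r k"
  using assms recip_inverse [OF zero_in_exponent_seqs]
  by (auto simp: less_complexity_rate_def rate_infinity_def less_fun_def)

lemma rate_denom_pos: "1 \<le> p \<Longrightarrow> 0 < rate_denom r p"
proof -
  assume "1 \<le> p"
  have "iterated_ln i (real p) \<noteq> 0" for i
    using iterated_ln_ge_1 [of i "real p"] by linarith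
  with \<open>1 \<le> p\<close> show ?thesis
    unfolding rate_denom_def by (intro mult_pos_pos prod_pos) auto
qed

text \<open>Every logarithmic factor is at least 1, and some exponent is positive because the rate lies strictly
  below the maximal one; that single exponent already forces the quotient to infinity, however
  slowly.\<close>

lemma rate_denom_superlinear:
  assumes "rate_zero < r" "r < rate_infinity"
  shows "filterlim (\<lambda>p. rate_denom r p / real p) at_top sequentially"
proof -
  define a where "a = (\<lambda>i. real_of_ereal (exponents r i))"
  define I where "I = {i. 1 \<le> i \<and> exponents r i \<noteq> 0}"
  have I: "finite I"
    by (rule finite_subset [OF _ finite_exponents [of r]]) (auto simp: I_def)
  have a: "0 \<le> a i" for i
    by (simp add: a_def exponents_nonneg real_of_ereal_pos)
  have factor_ge_1: "1 \<le> iterated_ln i x powr a i" for i x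
    by (rule ge_one_powr_ge_zero [OF iterated_ln_ge_1 a])
  have eq: "rate_denom r p / real p = real p powr a 0 * (\<Prod>i\<in>I. iterated_ln i (real p) powr a i)"
    if "1 \<le> p" for p
    using that by (simp add: rate_denom_def a_def I_def powr_add)
  obtain k where k: "0 < exponents r k"
    using exponents_pos [OF assms(2)] by blast
  then have ak: "0 < a k"
    using exponents_finite [OF assms(1), of k] by (cases "exponents r k") (auto simp: a_def)
  show ?thesis
  proof (cases "k = 0")
    case True
    have "filterlim (\<lambda>p. real p powr a 0) at_top sequentially"
      using ak True by (intro filterlim_compose [OF powr_at_top filterlim_real_sequentially]) simp
    moreover have "\<forall>\<^sub>F p in sequentially. real p powr a 0 \<le> rate_denom r p / real p"
      using eventually_ge_at_top [of 1]
    proof eventually_elim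
      case (elim p)
      have "real p powr a 0 * 1 \<le> real p powr a 0 * (\<Prod>i\<in>I. iterated_ln i (real p) powr a i)"
        by (intro mult_left_mono prod_ge_1 factor_ge_1) auto
      then show ?case by (simp add: eq [OF elim])
    qed
    ultimately show ?thesis by (rule filterlim_at_top_mono)
  next
    case False
    with k have kI: "k \<in> I" by (simp add: I_def)
    have "filterlim (\<lambda>p. iterated_ln k (real p) powr a k) at_top sequentially"
      by (rule filterlim_compose [OF powr_at_top [OF ak]
            filterlim_compose [OF iterated_ln_at_top filterlim_real_sequentially]])
    moreover have "\<forall>\<^sub>F p in sequentially. iterated_ln k (real p) powr a k \<le> rate_denom r p / real p"
      using eventually_ge_at_top [of 1]
    proof eventually_elim
      case (elim p)
      have "1 * (iterated_ln k (real p) powr a k * 1)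
          \<le> real p powr a 0 * (iterated_ln k (real p) powr a k
              * (\<Prod>i\<in>I - {k}. iterated_ln i (real p) powr a i))"
        using elim a by (intro mult_mono prod_ge_1 factor_ge_1 ge_one_powr_ge_zero) auto
      then show ?case by (simp add: eq [OF elim] prod.remove [OF I kI])
    qed
    ultimately show ?thesis by (rule filterlim_at_top_mono)
  qed
qed

text \<open>Along an increasing sequence the terms can be made smaller than those of a geometric series.\<close>

lemma tendsto_0_imp_summable_on_infinite_subset:
  fixes f :: "nat \<Rightarrow> real"
  assumes "f \<longlonglongrightarrow> 0" and nonneg: "\<And>n. 0 \<le> f n"
  obtains A where "infinite A" "A \<subseteq> {m..}" "f summable_on A"
proof -
  have small: "\<exists>i>j. m \<le> i \<and> f i \<le> (1 / 2) ^ n" for n j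
  proof -
    have "\<forall>\<^sub>F i in sequentially. f i < (1 / 2) ^ n \<and> j < i \<and> m \<le> i"
      using order_tendstoD(2) [OF assms(1), of "(1 / 2) ^ n"]
      by (intro eventually_conj eventually_gt_at_top eventually_ge_at_top) auto
    then show ?thesis
      using eventually_happens [of _ sequentially] by (fastforce simp: less_imp_le)
  qed
  have "\<exists>r. \<forall>n. (m \<le> r n \<and> f (r n) \<le> (1 / 2) ^ n) \<and> r n < r (Suc n)"
    by (rule dependent_nat_choice) (use small in blast)+
  then obtain r where r: "\<And>n. m \<le> r n" "\<And>n. f (r n) \<le> (1 / 2) ^ n" "strict_mono r"
    by (auto simp: strict_mono_Suc_iff)
  have inj: "inj r" by (rule strict_mono_imp_inj_on [OF r(3)])
  have "summable (f \<circ> r)"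
    by (rule summable_comparison_test' [OF summable_geometric [of "1 / 2 :: real"]])
      (use r nonneg in auto)
  then have "f summable_on range r"
    using nonneg by (simp add: summable_on_reindex [OF inj] summable_on_UNIV_nonneg_real_iff)
  moreover have "infinite (range r)"
    using inj by (simp add: finite_image_iff)
  ultimately show thesis
    using that r(1) by blast
qed


section \<open>The embedding\<close>

lemma lipschitz_const_mazur_map:
  assumes q: "2 \<le> q"
  shows "0 \<le> lipschitz_const (sphere_metric (lp q) (pts (lp q))) (sphere_metric (lp 2) (pts (lp 2))) (mazur_map q)"
    and "lipschitz_const (sphere_metric (lp q) (pts (lp q))) (sphere_metric (lp 2) (pts (lp 2))) (mazur_map q) \<le> q"
proof -
  let ?L = "{L. 0 \<le> L \<and>
          (\<forall>x\<in>mspace (sphere_metric (lp q) (pts (lp q))). \<forall>y\<in>mspace (sphere_metric (lp q) (pts (lp q))).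
            mdist (sphere_metric (lp 2) (pts (lp 2))) (mazur_map q x) (mazur_map q y)
              \<le> L * mdist (sphere_metric (lp q) (pts (lp q))) x y)}"
  have mem: "q \<in> ?L"
    using q mazur_map_lipschitz [OF q] by simp
  then show "0 \<le> lipschitz_const (sphere_metric (lp q) (pts (lp q))) (sphere_metric (lp 2) (pts (lp 2))) (mazur_map q)"
    unfolding lipschitz_const_def by (intro cInf_greatest) auto
  from mem show "lipschitz_const (sphere_metric (lp q) (pts (lp q))) (sphere_metric (lp 2) (pts (lp 2))) (mazur_map q) \<le> q"
    unfolding lipschitz_const_def by (rule cInf_lower) (auto intro: bdd_belowI [of _ 0])
qed

text \<open>Any \<open>n\<close> elements of \<open>A\<close> contribute at least \<open>n\<close> once \<open>t\<close> exceeds their finitely many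
  thresholds.\<close>

lemma infsum_indicator_tendsto_infinity:
  fixes N :: "nat \<Rightarrow> real"
  assumes "infinite A" "A \<subseteq> B"
  shows "((\<lambda>t. \<Sum>\<^sub>\<infinity>p\<in>B. ennreal ((if p \<in> A \<and> N p \<le> t then 1 else 0)\<^sup>2)) \<longlongrightarrow> \<infinity>) at_top"
  unfolding infinity_ennreal_def tendsto_top_iff_ennreal
proof (intro allI impI)
  fix l :: real assume "0 \<le> l"
  obtain n :: nat where n: "l < real n" using reals_Archimedean2 by blast
  obtain F where F: "finite F" "card F = n" "F \<subseteq> A"
    using infinite_arbitrarily_large [OF assms(1)] by blast
  have "\<forall>\<^sub>F t in at_top. \<forall>p\<in>F. N p \<le> t"
    using F(1) by (intro eventually_ball_finite ballI eventually_ge_at_top)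
  then show "\<forall>\<^sub>F t in at_top. ennreal l < (\<Sum>\<^sub>\<infinity>p\<in>B. ennreal ((if p \<in> A \<and> N p \<le> t then 1 else 0)\<^sup>2))"
  proof eventually_elim
    case (elim t)
    have "ennreal l < ennreal (real n)"
      using n \<open>0 \<le> l\<close> by (simp add: ennreal_less_iff)
    also have "\<dots> = (\<Sum>p\<in>F. 1)"
      by (simp add: F(2) ennreal_of_nat_eq_real_of_nat)
    also have "\<dots> = (\<Sum>p\<in>F. ennreal ((if p \<in> A \<and> N p \<le> t then 1 else 0)\<^sup>2))"
      using elim F(3) by (intro sum.cong) auto
    also have "\<dots> \<le> (\<Sum>\<^sub>\<infinity>p\<in>B. ennreal ((if p \<in> A \<and> N p \<le> t then 1 else 0)\<^sup>2))"
      unfolding nonneg_infsum_complete [of B "\<lambda>p. ennreal ((if p \<in> A \<and> N p \<le> t then 1 else 0)\<^sup>2)", OF zero_le]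
      using F assms(2) by (intro SUP_upper) auto
    finally show ?case .
  qed
qed

text \<open>Keeping only the coordinates in a sparse set \<open>A\<close> is harmless for the lower bound, which needs
  infinitely many coordinates and nothing more, while it makes the upper bounds summable.\<close>

lemma finite_complexity_embedding_of_rate:
  fixes G (structure)
  assumes "group G" and S: "S \<subseteq> carrier G" "generate G S = carrier G"
    and r: "r < rate_infinity" and CR: "CR_le (carrier G) (word_dist G S) r"
  shows "\<exists>h. finite_complexity_embedding (carrier G) (word_dist G S)
           (\<lambda>p. lp (2 * real p)) (lp 2) (\<lambda>p. mazur_map (2 * real p)) h"
proof -
  interpret group G by fact
  define d where "d = word_dist G S"
  define D where "D = rate_denom r"
  have D: "0 < D p" if "1 \<le> p" for p
    unfolding D_def by (rule rate_denom_pos [OF that])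
  obtain C \<tau> where r0: "rate_zero < r" and C: "0 < C"
    and \<tau>: "\<And>p. 1 \<le> p \<Longrightarrow> \<tau> p \<in> carrier G \<rightarrow> pts (lp (2 * real p))"
    and var: "\<And>p. 1 \<le> p \<Longrightarrow> has_variation (carrier G) d (lp (2 * real p)) (\<tau> p) 1 (C / D p)"
    and "\<And>p. 1 \<le> p \<Longrightarrow> \<exists>N>0. \<forall>x\<in>carrier G. \<forall>y\<in>carrier G. N \<le> d x y \<longrightarrow> 1 \<le> nrm (lp (2 * real p)) (\<tau> p x - \<tau> p y)"
    using CR unfolding CR_le_def d_def D_def by blast
  then obtain N :: "nat \<Rightarrow> real"
    where N: "\<And>p x y. \<lbrakk>1 \<le> p; x \<in> carrier G; y \<in> carrier G; N p \<le> d x y\<rbrakk>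
      \<Longrightarrow> 1 \<le> nrm (lp (2 * real p)) (\<tau> p x - \<tau> p y)"
    by metis
  have "(\<lambda>p. inverse (D p / real p)) \<longlonglongrightarrow> 0"
    unfolding D_def by (rule tendsto_inverse_0_at_top [OF rate_denom_superlinear [OF r0 r]])
  from tendsto_power [OF this, of 2]
  obtain A where A: "infinite A" "A \<subseteq> {1..}" and summable: "(\<lambda>p. (real p / D p)\<^sup>2) summable_on A"
    by (rule_tac tendsto_0_imp_summable_on_infinite_subset [of "\<lambda>p. (real p / D p)\<^sup>2" 1]) auto
  \<comment> \<open>Subtracting the value at the identity makes the family square summable at every group element.\<close>
  define h where "h = (\<lambda>x p. if p \<in> A then \<tau> p x - \<tau> p \<one> else 0)"
  define \<rho>l where "\<rho>l = (\<lambda>p t. if p \<in> A \<and> N p \<le> t then 1 else 0 :: real)"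
  define \<rho>u where "\<rho>u = (\<lambda>p t. if p \<in> A then t * (C / D p) else 0)"
  have q: "2 \<le> 2 * real p" if "1 \<le> p" for p using that by simp
  have q1: "1 \<le> 2 * real p" if "1 \<le> p" for p using that by simp
  have upper: "nrm (lp (2 * real p)) (\<tau> p x - \<tau> p y) \<le> d x y * (C / D p)"
    if "1 \<le> p" "x \<in> carrier G" "y \<in> carrier G" for p x y
    using variation_imp_lipschitz [OF S lp_normed_space [OF q1] \<tau> var [unfolded d_def]] that
    by (simp add: d_def)
  have diff: "h x p - h y p = (if p \<in> A then \<tau> p x - \<tau> p y else 0)" for x y p
    by (simp add: h_def)
  \<comment> \<open>Both summability conditions reduce to the choice of the set, with a factor depending only on the point or on \<open>t\<close>.\<close>
  have summable_le: "f summable_on B"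
    if "A \<subseteq> B" "B \<subseteq> {1..}" "\<And>p. 0 \<le> f p" "\<And>p. p \<notin> A \<Longrightarrow> f p = 0"
      and le: "\<And>p. 1 \<le> p \<Longrightarrow> p \<in> A \<Longrightarrow> f p \<le> (c * (real p / D p))\<^sup>2" for f :: "nat \<Rightarrow> real" and B c
  proof -
    have "f summable_on A"
    proof (rule summable_on_comparison_test)
      show "(\<lambda>p. c\<^sup>2 * (real p / D p)\<^sup>2) summable_on A"
        by (rule summable_on_cmult_right [OF summable])
      show "f p \<le> c\<^sup>2 * (real p / D p)\<^sup>2" if "p \<in> A" for p
      proof -
        have "1 \<le> p" using that A(2) by auto
        from le [OF this that] show ?thesis by (simp only: power_mult_distrib)
      qed
    qed (use that in auto)
    also have "f summable_on A \<longleftrightarrow> f summable_on B"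
      using that by (intro summable_on_cong_neutral) auto
    finally show ?thesis .
  qed
  have controls: "\<exists>f g. P f g" if "P \<rho>l \<rho>u" for P
    using that by blast
  have "finite_complexity_embedding (carrier G) d
           (\<lambda>p. lp (2 * real p)) (lp 2) (\<lambda>p. mazur_map (2 * real p)) h"
    unfolding finite_complexity_embedding_def
  proof (intro conjI controls exI [of _ "0::nat"] allI impI ballI)
    fix p :: nat assume "1 \<le> p"
    then show "property_H_map (lp (2 * real p)) (lp 2) (mazur_map (2 * real p))"
      by (intro mazur_map_property_H q)
  next
    show "h \<in> carrier G \<rightarrow> pts (l2_direct_sum (\<lambda>p. lp (2 * real p)))"
    proof
      fix x assume x: "x \<in> carrier G"
      have "h x p \<in> pts (lp (2 * real p))" if "1 \<le> p" for p
      proof -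
        have "\<tau> p x - \<tau> p \<one> \<in> pts (lp (2 * real p))"
          by (intro lp_diff q1 that funcset_mem [OF \<tau> [OF that]] x one_closed)
        then show ?thesis
          unfolding h_def using lp_zero(1) by (simp del: lp_mem)
      qed
      moreover have "h x p = 0" if "p \<notin> {1..}" for p
        using that A(2) by (auto simp: h_def)
      moreover have "(\<lambda>p. (nrm (lp (2 * real p)) (h x p))\<^sup>2) summable_on {1..}"
      proof (rule summable_le [OF A(2) order_refl])
        fix p assume p: "1 \<le> p" "p \<in> A"
        have "nrm (lp (2 * real p)) (h x p) \<le> d x \<one> * (C / D p)"
          using upper [OF p(1) x one_closed] p by (simp add: h_def)
        also have "\<dots> \<le> d x \<one> * (C / D p) * real p"
          using p D [OF p(1)] C mult_left_mono [of 1 "real p" "d x \<one> * (C / D p)"]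
          by (simp add: d_def word_dist_def)
        also have "\<dots> = d x \<one> * C * (real p / D p)"
          by simp
        finally show "(nrm (lp (2 * real p)) (h x p))\<^sup>2 \<le> (d x \<one> * C * (real p / D p))\<^sup>2"
          by (intro power_mono) auto
      qed (auto simp: h_def lp_zero)
      ultimately show "h x \<in> pts (l2_direct_sum (\<lambda>p. lp (2 * real p)))"
        by (simp add: l2_direct_sum_def del: lp_mem)
    qed
  next
    fix p :: nat and t :: real assume "1 \<le> p" "0 \<le> t"
    then show "0 \<le> \<rho>l p t" "0 \<le> \<rho>u p t"
      using C D [of p] by (auto simp: \<rho>l_def \<rho>u_def)
  next
    fix p :: nat and x y assume "1 \<le> p" "x \<in> carrier G" "y \<in> carrier G"
    then show "\<rho>l p (d x y) \<le> nrm (lp (2 * real p)) (h x p - h y p)"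
      "nrm (lp (2 * real p)) (h x p - h y p) \<le> \<rho>u p (d x y)"
      using N upper by (auto simp: diff \<rho>l_def \<rho>u_def lp_zero)
  next
    show "((\<lambda>t. \<Sum>\<^sub>\<infinity>p\<in>{1..}. ennreal ((\<rho>l p t)\<^sup>2)) \<longlongrightarrow> \<infinity>) at_top"
      unfolding \<rho>l_def by (rule infsum_indicator_tendsto_infinity [OF A])
  next
    fix p :: nat assume "0 < p"
    then show "Lipschitz_continuous_map (sphere_metric (lp (2 * real p)) (pts (lp (2 * real p))))
        (sphere_metric (lp 2) (pts (lp 2))) (mazur_map (2 * real p))"
      using mazur_map_unit_sphere_restrict(1) [of "2 * real p"]
      by (intro mazur_map_Lipschitz_continuous q) (auto simp: unit_sphere_def)
  next
    fix t :: real assume t: "0 < t"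
    let ?L = "\<lambda>p. lipschitz_const (sphere_metric (lp (2 * real p)) (pts (lp (2 * real p))))
        (sphere_metric (lp 2) (pts (lp 2))) (mazur_map (2 * real p))"
    show "(\<lambda>p. ((?L p + 1) * \<rho>u p t)\<^sup>2) summable_on {0<..}"
    proof (rule summable_le)
      fix p :: nat assume p: "1 \<le> p" "p \<in> A"
      \<comment> \<open>The Lipschitz constant is at most \<open>2 p\<close>, and 1 is at most \<open>p\<close>.\<close>
      have L: "0 \<le> ?L p" "?L p + 1 \<le> 3 * real p"
        using lipschitz_const_mazur_map [OF q [OF p(1)]] p by auto
      have "(?L p + 1) * (t * (C / D p)) \<le> 3 * real p * (t * (C / D p))"
        using L t C D [OF p(1)] by (intro mult_right_mono) auto
      also have "\<dots> = 3 * t * C * (real p / D p)"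
        by simp
      finally show "((?L p + 1) * \<rho>u p t)\<^sup>2 \<le> (3 * t * C * (real p / D p))\<^sup>2"
        using L t C D [OF p(1)] p by (intro power_mono) (auto simp: \<rho>u_def)
    qed (use A(2) in \<open>auto simp: \<rho>u_def\<close>)
  qed
  then show ?thesis unfolding d_def by blast
qed

theorem proposition1p4:
  fixes \<Gamma> :: "('g, 'm) monoid_scheme" and S :: "'g set"
  assumes "group \<Gamma>"
    and "finite S" and "S \<subseteq> carrier \<Gamma>" and "generate \<Gamma> S = carrier \<Gamma>"
    and "CR_less (carrier \<Gamma>) (word_dist \<Gamma> S) rate_infinity"
  shows "\<exists>h. finite_complexity_embedding (carrier \<Gamma>) (word_dist \<Gamma> S)
           (\<lambda>p. lp (2 * real p)) (lp 2) (\<lambda>p. mazur_map (2 * real p)) h"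
  using assms finite_complexity_embedding_of_rate unfolding CR_less_def by blast

end
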